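(* Let $n\ge 3$ and let $\mathbb{M}^n$ be a Cartan-Hadamard model manifold associated to a function $\psi$ with $\Theta\notin L^1(\mathbb{R}^+)$. Let $p,q>0$ satisfy $\frac{1}{p+1}+\frac{1}{q+1}\le\frac{n-2}{n}$. Then for each $\xi>0$ there exists one and only one value $\eta\equiv\eta(\xi)>0$ such that $(\xi,\eta)$ gives rise to a globally positive solution $(u,v)$ of the Cauchy problem $CP(\xi,\eta)$, and this solution satisfies $\lim_{r\to+\infty}u(r)=\lim_{r\to+\infty}v(r)=0$. Moreover, the function $\xi\mapsto\eta(\xi)$ is a continuous and strictly increasing bijection of $(0,+\infty)$ into itself.
   Context: A (noncompact) model manifold $\mathbb{M}^n$ associated to $\psi$ is a Riemannian manifold whose metric, in global polar coordinates $(r,\vartheta)\in\mathbb{R}^+\times\mathbb{S}^{n-1}$ about a pole $o$, is $g=dr\otimes dr+\psi^2(r)\,g_{\mathbb{S}^{n-1}}$, where $\psi\in C^1([0,+\infty))\cap C^\infty((0,+\infty))$, $\psi>0$ on $(0,+\infty)$, $\psi(0)=0$, $\psi'(0)=1$. It is Cartan-Hadamard if and only if $\psi$ is in addition convex. Set $\Theta(r):=\frac{1}{\psi^{n-1}(r)}\int_0^r\psi^{n-1}\,ds$ for $r>0$. For $(\xi,\eta)\in(0,+\infty)^2$, $CP(\xi,\eta)$ denotes the Cauchy problem for functions $u,v$ of $r$ (of class $C^1$ up to $r=0$ and $C^2$ for $r>0$) $$(\psi^{n-1}u')'+\psi^{n-1}|v|^{q-1}v=0,\quad (\psi^{n-1}v')'+\psi^{n-1}|u|^{p-1}u=0\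 \ (r>0),\quad u'(0)=v'(0)=0,\ u(0)=\xi,\ v(0)=\eta.$$ A globally positive solution is a solution defined for every $r>0$ with $u,v>0$ on $[0,+\infty)$; its components are decreasing, so the limits at infinity exist. *)

theory Defs
  imports "HOL-Analysis.Analysis"
begin

text \<open>
  Functions on the half-line \<open>[0,\<infinity>)\<close> are represented by functions on the reals whose values at
  negative arguments are irrelevant; derivatives at \<open>0\<close> are therefore one-sided.
\<close>

definition C1_halfline :: "(real \<Rightarrow> real) \<Rightarrow> bool" where
  "C1_halfline f \<longleftrightarrow>
     (\<exists>f'. (\<forall>r\<ge>0. (f has_real_derivative f' r) (at r within {0..})) \<and> continuous_on {0..} f')"

text \<open>Meant for open \<open>S\<close> only, since the derivatives are two-sided.\<close>

definition Ck_on :: "nat \<Rightarrow> (real \<Rightarrow> real) \<Rightarrow> real set \<Rightarrow> bool" where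
  "Ck_on k f S \<longleftrightarrow>
     (\<forall>j<k. \<forall>r\<in>S. (deriv ^^ j) f differentiable (at r)) \<and> continuous_on S ((deriv ^^ k) f)"

definition model_function :: "(real \<Rightarrow> real) \<Rightarrow> bool" where
  "model_function \<psi> \<longleftrightarrow>
     C1_halfline \<psi> \<and> (\<forall>k. Ck_on k \<psi> {0<..}) \<and> (\<forall>r>0. \<psi> r > 0) \<and>
     \<psi> 0 = 0 \<and> (\<psi> has_real_derivative 1) (at 0 within {0..})"

text \<open>
  The model manifold enters only through \<open>\<psi>\<close> (and its dimension \<open>n\<close>): the metric
  \<open>dr\<^sup>2 + \<psi>\<^sup>2(r) g\<close> on \<open>\<real>\<^sup>+ \<times> S\<^bsup>n-1\<^esup>\<close> is Cartan-Hadamard iff \<open>\<psi>\<close> is convex.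
\<close>

definition cartan_hadamard_model :: "(real \<Rightarrow> real) \<Rightarrow> bool" where
  "cartan_hadamard_model \<psi> \<longleftrightarrow> model_function \<psi> \<and> convex_on {0..} \<psi>"

definition Theta :: "(real \<Rightarrow> real) \<Rightarrow> nat \<Rightarrow> real \<Rightarrow> real" where
  "Theta \<psi> n r = 1 / \<psi> r ^ (n - 1) * (LINT s:{0..r}|lborel. \<psi> s ^ (n - 1))"

definition solves_CP ::
  "(real \<Rightarrow> real) \<Rightarrow> nat \<Rightarrow> real \<Rightarrow> real \<Rightarrow> real \<Rightarrow> real \<Rightarrow> (real \<Rightarrow> real) \<Rightarrow> (real \<Rightarrow> real) \<Rightarrow> bool" where
  "solves_CP \<psi> n p q \<xi> \<eta> u v \<longleftrightarrow>
     C1_halfline u \<and> C1_halfline v \<and> Ck_on 2 u {0<..} \<and> Ck_on 2 v {0<..} \<and>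
     (\<forall>r>0. ((\<lambda>s. \<psi> s ^ (n - 1) * deriv u s) has_real_derivative
               - (\<psi> r ^ (n - 1) * \<bar>v r\<bar> powr (q - 1) * v r)) (at r)) \<and>
     (\<forall>r>0. ((\<lambda>s. \<psi> s ^ (n - 1) * deriv v s) has_real_derivative
               - (\<psi> r ^ (n - 1) * \<bar>u r\<bar> powr (p - 1) * u r)) (at r)) \<and>
     (u has_real_derivative 0) (at 0 within {0..}) \<and>
     (v has_real_derivative 0) (at 0 within {0..}) \<and>
     u 0 = \<xi> \<and> v 0 = \<eta>"

definition globally_positive_solution ::
  "(real \<Rightarrow> real) \<Rightarrow> nat \<Rightarrow> real \<Rightarrow> real \<Rightarrow> real \<Rightarrow> real \<Rightarrow> (real \<Rightarrow> real) \<Rightarrow> (real \<Rightarrow> real) \<Rightarrow> bool" where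
  "globally_positive_solution \<psi> n p q \<xi> \<eta> u v \<longleftrightarrow>
     solves_CP \<psi> n p q \<xi> \<eta> u v \<and> (\<forall>r\<ge>0. u r > 0 \<and> v r > 0)"

end

theory Submission
  imports Defs
begin

text \<open>
  In integrated form the system reads \<open>u = \<xi> - G(v\<^sup>q)\<close>, \<open>v = \<eta> - G(u\<^sup>p)\<close> with a positive operator \<open>G\<close>, so
  it is competitive: for \<open>\<xi>\<^sub>2 \<le> \<xi>\<^sub>1\<close> and \<open>\<eta>\<^sub>1 < \<eta>\<^sub>2\<close> one has \<open>u\<^sub>2 \<le> u\<^sub>1\<close> and \<open>v\<^sub>2 - v\<^sub>1 \<ge> \<eta>\<^sub>2 - \<eta>\<^sub>1\<close> for ever.
  Since \<open>\<Theta>\<close> is not integrable, a globally positive solution tends to \<open>0\<close>, and comparison yields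
  uniqueness and strict monotonicity of \<open>\<eta>\<close>. For existence, shoot in \<open>\<eta>\<close>: if \<open>\<eta>\<close> is small then \<open>v\<close>
  vanishes first, if it is large then \<open>u\<close> does, and a Pohozaev identity excludes simultaneous
  vanishing. At the supremum of the first kind of data, the limits of the solutions from below and
  from above would cross zero in different components unless a globally positive solution exists.
  Exchanging the roles of \<open>u\<close> and \<open>v\<close> gives surjectivity of \<open>\<eta>\<close>, hence its continuity.
\<close>

section \<open>Truncated powers and one-sided calculus on the half-line\<close>

definition pos_power :: "real \<Rightarrow> real \<Rightarrow> real" where
  "pos_power q x = max x 0 powr q"

lemma pos_power_mono: "q > 0 \<Longrightarrow> x \<le> y \<Longrightarrow> pos_power q x \<le> pos_power q y"
  unfolding pos_power_def by (intro powr_mono2) auto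

lemma pos_power_nonneg: "pos_power q x \<ge> 0"
  by (simp add: pos_power_def)

lemma pos_power_pos: "x > 0 \<Longrightarrow> pos_power q x > 0"
  by (simp add: pos_power_def)

lemma continuous_on_pos_power [continuous_intros]:
  "q > 0 \<Longrightarrow> continuous_on S f \<Longrightarrow> continuous_on S (\<lambda>x. pos_power q (f x))"
  unfolding pos_power_def
  by (intro continuous_on_powr' continuous_intros) auto

text \<open>The interval is compact and avoids \<open>0\<close>, where the derivative
  \<open>q * x powr (q - 1)\<close> is singular for \<open>q < 1\<close>; so this derivative is
  bounded and the mean value inequality applies.\<close>

lemma pos_power_Lipschitz:
  assumes "0 < \<epsilon>"
  shows "\<exists>L>0. \<forall>x\<in>{\<epsilon>..b}. \<forall>y\<in>{\<epsilon>..b}. \<bar>pos_power q x - pos_power q y\<bar> \<le> L * \<bar>x - y\<bar>"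
proof -
  have "continuous_on {\<epsilon>..b} (\<lambda>x. q * x powr (q - 1))"
    using assms by (intro continuous_intros) auto
  then have "bounded ((\<lambda>x. q * x powr (q - 1)) ` {\<epsilon>..b})"
    by (intro compact_imp_bounded compact_continuous_image) auto
  then obtain L where L: "L > 0" "\<And>x. x \<in> {\<epsilon>..b} \<Longrightarrow> \<bar>q * x powr (q - 1)\<bar> \<le> L"
    unfolding bounded_pos by auto
  have *: "\<bar>x powr q - y powr q\<bar> \<le> L * \<bar>x - y\<bar>" if "x \<in> {\<epsilon>..b}" "y \<in> {\<epsilon>..b}" for x y
  proof -
    have "norm (x powr q - y powr q) \<le> L * norm (x - y)"
    proof (rule field_differentiable_bound[of "{\<epsilon>..b}"])
      show "((\<lambda>x. x powr q) has_real_derivative q * z powr (q - 1)) (at z within {\<epsilon>..b})"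
        if "z \<in> {\<epsilon>..b}" for z
        using that assms by (intro DERIV_subset[OF has_real_derivative_powr]) auto
    qed (use that L in auto)
    then show ?thesis by simp
  qed
  show ?thesis
    using * L(1) assms by (intro exI[of _ L]) (auto simp: pos_power_def max_def)
qed

lemma integral_has_real_derivative_halfline:
  fixes g :: "real \<Rightarrow> real"
  assumes "continuous_on {0..} g" "r \<ge> 0"
  shows "((\<lambda>x. integral {0..x} g) has_real_derivative g r) (at r within {0..})"
proof -
  have "((\<lambda>x. integral {0..x} g) has_real_derivative g r) (at r within {0..r+1})"
    using assms by (intro integral_has_real_derivative) (auto intro: continuous_on_subset)
  \<comment> \<open>The fundamental theorem is used on a compact interval reaching beyond
    \<open>r\<close>; the filter only sees a neighbourhood of \<open>r\<close>.\<close>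
  moreover have "at r within {0..r+1} = at r within {0..}"
    by (rule at_within_nhd[of _ "{..<r+1}"]) auto
  ultimately show ?thesis by simp
qed

lemma at_within_halfline: "r > 0 \<Longrightarrow> at r within {0..} = at (r::real)"
  by (rule at_within_interior) (simp add: interior_Ici[of "-1"])

lemma bounded_on_interval:
  fixes h :: "real \<Rightarrow> real"
  assumes "continuous_on {0..} h"
  obtains C where "C > 0" "\<And>s. s \<in> {0..b} \<Longrightarrow> \<bar>h s\<bar> \<le> C"
proof -
  have "bounded (h ` {0..b})"
    by (intro compact_imp_bounded compact_continuous_image continuous_on_subset[OF assms]) auto
  then show ?thesis using that unfolding bounded_pos by auto
qed

lemma strictly_decreasing_from_derivative_halfline:
  fixes u u' :: "real \<Rightarrow> real"
  assumes "\<And>r. r \<ge> 0 \<Longrightarrow> (u has_real_derivative u' r) (at r within {0..})"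
    and "\<And>r. r > 0 \<Longrightarrow> u' r < 0" and "0 \<le> r" "r < s"
  shows "u s < u r"
proof (rule DERIV_neg_imp_decreasing_open[OF \<open>r < s\<close>])
  show "\<exists>y. (u has_real_derivative y) (at x) \<and> y < 0" if "r < x" "x < s" for x
    using assms(1)[of x] assms(2)[of x] assms(3) that at_within_halfline[of x] by force
  have "continuous_on {0..} u"
    using assms(1) by (auto intro!: DERIV_continuous_on)
  then show "continuous_on {r..s} u"
    by (rule continuous_on_subset) (use assms in auto)
qed

subsection \<open>Inverting the radial Laplacian\<close>

text \<open>For a radial function, \<open>w = \<psi>\<^bsup>n-1\<^esup>\<close> turns \<open>flux\<close>, \<open>slope\<close> and \<open>potential\<close> into the
  successive integrations that invert the radial Laplacian \<open>w\<^sup>-\<^sup>1(w u')'\<close> with \<open>u'(0) = 0\<close>.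
  At \<open>r = 0\<close> the quotient in \<open>slope\<close> is \<open>0 / 0 = 0\<close>, which is its continuous extension.\<close>

locale radial_weight =
  fixes w w' :: "real \<Rightarrow> real"
  assumes w_cont: "continuous_on {0..} w"
    and w_0: "w 0 = 0"
    and w_pos: "r > 0 \<Longrightarrow> w r > 0"
    and w_mono: "0 \<le> r \<Longrightarrow> r \<le> s \<Longrightarrow> w r \<le> w s"
    and w_deriv: "r > 0 \<Longrightarrow> (w has_real_derivative w' r) (at r)"
    and w'_cont: "continuous_on {0<..} w'"
begin

definition flux :: "(real \<Rightarrow> real) \<Rightarrow> real \<Rightarrow> real" where
  "flux h r = integral {0..r} (\<lambda>s. w s * h s)"

definition slope :: "(real \<Rightarrow> real) \<Rightarrow> real \<Rightarrow> real" where
  "slope h r = flux h r / w r"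

definition potential :: "(real \<Rightarrow> real) \<Rightarrow> real \<Rightarrow> real" where
  "potential h r = integral {0..r} (slope h)"

lemma w_nonneg: "r \<ge> 0 \<Longrightarrow> w r \<ge> 0"
  using w_pos[of r] w_0 by (cases "r = 0") auto

lemma flux_integrable:
  "continuous_on {0..} h \<Longrightarrow> (\<lambda>s. w s * h s) integrable_on {0..r}"
  by (intro integrable_continuous_real continuous_on_mult continuous_on_subset[OF w_cont])
    (auto intro: continuous_on_subset)

lemma flux_0 [simp]: "flux h 0 = 0" and slope_0 [simp]: "slope h 0 = 0"
  and potential_0 [simp]: "potential h 0 = 0"
  by (simp_all add: flux_def slope_def potential_def)

lemma flux_has_derivative:
  assumes "continuous_on {0..} h" "r \<ge> 0"
  shows "(flux h has_real_derivative w r * h r) (at r within {0..})"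
  unfolding flux_def
  by (intro integral_has_real_derivative_halfline continuous_intros w_cont assms)

lemma flux_mono:
  assumes "continuous_on {0..} h" "continuous_on {0..} k" "\<And>s. s \<in> {0..r} \<Longrightarrow> h s \<le> k s"
  shows "flux h r \<le> flux k r"
  unfolding flux_def
  using assms by (intro integral_le flux_integrable) (auto intro!: mult_left_mono w_nonneg)

text \<open>Since \<open>w\<close> increases, the integrand is at most \<open>w r * C\<close>.
  Dividing by \<open>w r\<close> then controls \<open>slope\<close> linearly near the pole, whatever
  the rate at which \<open>w\<close> vanishes there.\<close>

lemma flux_bound:
  assumes "\<And>s. s \<in> {0..r} \<Longrightarrow> \<bar>h s\<bar> \<le> C" "continuous_on {0..} h" "r \<ge> 0"
  shows "\<bar>flux h r\<bar> \<le> C * r * w r"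
proof -
  have "norm (integral {0..r} (\<lambda>s. w s * h s)) \<le> integral {0..r} (\<lambda>s. w r * C)"
  proof (intro integral_norm_bound_integral flux_integrable assms)
    show "norm (w x * h x) \<le> w r * C" if "x \<in> {0..r}" for x
      using w_mono[of x r] w_nonneg[of x] assms(1)[OF that] that
      by (auto simp: abs_mult intro!: mult_mono)
  qed auto
  then show ?thesis using assms(3) by (simp add: flux_def algebra_simps)
qed

lemma slope_mono:
  assumes "continuous_on {0..} h" "continuous_on {0..} k" "\<And>s. s \<in> {0..r} \<Longrightarrow> h s \<le> k s" "r \<ge> 0"
  shows "slope h r \<le> slope k r"
  unfolding slope_def using flux_mono[of h k r] assms w_nonneg by (intro divide_right_mono) auto

lemma slope_bound:
  assumes "\<And>s. s \<in> {0..r} \<Longrightarrow> \<bar>h s\<bar> \<le> C" "continuous_on {0..} h" "r \<ge> 0"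
  shows "\<bar>slope h r\<bar> \<le> C * r"
proof (cases "r = 0")
  case False
  then show ?thesis
    using flux_bound[of r h C, OF assms] w_pos[of r] assms(3)
    by (auto simp: slope_def abs_mult field_simps)
qed auto

lemma slope_continuous:
  assumes "continuous_on {0..} h"
  shows "continuous_on {0..} (slope h)"
  unfolding continuous_on_eq_continuous_within
proof
  fix r :: real assume r: "r \<in> {0..}"
  show "continuous (at r within {0..}) (slope h)"
  proof (cases "r = 0")
    case True
    obtain C where C: "C > 0" "\<And>s. s \<in> {0..1} \<Longrightarrow> \<bar>h s\<bar> \<le> C"
      using bounded_on_interval[OF assms, where b=1] by metis
    have "(slope h \<longlongrightarrow> 0) (at 0 within {0..})"
    proof (rule Lim_null_comparison)
      have "norm (slope h x) \<le> C * x" if "x \<in> {0..<1}" for x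
        using slope_bound[of x h C] C assms that by auto
      moreover have "\<forall>\<^sub>F x::real in at 0 within {0..}. x \<in> {0..<1}"
        unfolding eventually_at by (rule exI[of _ 1]) (auto simp: dist_real_def)
      ultimately show "\<forall>\<^sub>F x in at 0 within {0..}. norm (slope h x) \<le> C * x"
        by (rule eventually_mono[rotated])
      show "((*) C \<longlongrightarrow> 0) (at 0 within {0..})"
        by (rule tendsto_eq_intros refl tendsto_ident_at | simp)+
    qed
    then show ?thesis using True by (simp add: continuous_within)
  next
    case False
    have "continuous (at r within {0..}) (flux h)"
      using flux_has_derivative[OF assms, of r] r by (auto intro: DERIV_continuous)
    moreover have "continuous (at r within {0..}) w"
      using w_cont r by (auto simp: continuous_on_eq_continuous_within)
    ultimately show ?thesis
      unfolding slope_def[abs_def] using w_pos[of r] r False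
      by (auto simp: continuous_within intro!: tendsto_divide)
  qed
qed

lemma slope_integrable: "continuous_on {0..} h \<Longrightarrow> slope h integrable_on {r..s}" if "r \<ge> 0"
  using that by (intro integrable_continuous_real) (auto intro: continuous_on_subset slope_continuous)

lemma potential_has_derivative:
  assumes "continuous_on {0..} h" "r \<ge> 0"
  shows "(potential h has_real_derivative slope h r) (at r within {0..})"
  unfolding potential_def
  by (intro integral_has_real_derivative_halfline slope_continuous assms)

lemma potential_continuous: "continuous_on {0..} h \<Longrightarrow> continuous_on {0..} (potential h)"
  using potential_has_derivative by (auto intro!: DERIV_continuous_on)

lemma potential_mono:
  assumes "continuous_on {0..} h" "continuous_on {0..} k" "\<And>s. s \<in> {0..r} \<Longrightarrow> h s \<le> k s"
  shows "potential h r \<le> potential k r"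
  unfolding potential_def
  using assms by (intro integral_le slope_integrable slope_mono) auto

lemma slope_has_derivative:
  assumes "continuous_on {0..} h" "r > 0"
  shows "(slope h has_real_derivative h r - w' r * slope h r / w r) (at r)"
proof -
  have "((\<lambda>r. flux h r / w r) has_real_derivative
      (w r * h r * w r - flux h r * w' r) / (w r * w r)) (at r)"
    using flux_has_derivative[OF assms(1), of r] at_within_halfline[of r] w_deriv[of r] w_pos[of r] assms
    by (intro DERIV_divide) auto
  moreover have "(w r * h r * w r - flux h r * w' r) / (w r * w r) = h r - w' r * slope h r / w r"
    using w_pos[of r] assms by (simp add: slope_def field_simps)
  ultimately show ?thesis by (simp add: slope_def[abs_def])
qed

lemma slope_nonneg: "continuous_on {0..} h \<Longrightarrow> (\<And>s. s \<in> {0..r} \<Longrightarrow> 0 \<le> h s) \<Longrightarrow> r \<ge> 0 \<Longrightarrow> 0 \<le> slope h r"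
  using slope_mono[of "\<lambda>_. 0" h r] by (simp add: slope_def flux_def)

text \<open>Positivity of \<open>h\<close> at the pole persists on a short interval, where the flux
  strictly gains; later it cannot lose because \<open>h\<close> is nonnegative. This covers
  truncated powers, which may vanish further out.\<close>

lemma slope_pos:
  assumes h: "continuous_on {0..} h" "\<And>s. s \<ge> 0 \<Longrightarrow> 0 \<le> h s" "h 0 > 0" and r: "r > 0"
  shows "slope h r > 0"
proof -
  have "\<forall>\<^sub>F s in at 0 within {0..}. h s > 0"
    using h(1,3) by (auto simp: continuous_on_def intro: order_tendstoD(1))
  then obtain d where d: "d > 0" "\<And>s. 0 < s \<Longrightarrow> s < d \<Longrightarrow> h s > 0"
    unfolding eventually_at by (auto simp: dist_real_def)
  define b where "b = min r (d/2)"
  have b: "0 < b" "b \<le> r" "b < d" using d r by (auto simp: b_def)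
  have deriv: "(flux h has_real_derivative w x * h x) (at x)" if "x > 0" for x
    using flux_has_derivative[OF h(1), of x] at_within_halfline[of x] that by auto
  have cont: "continuous_on {0..} (flux h)"
    using flux_has_derivative[OF h(1)] by (auto intro!: DERIV_continuous_on)
  have "flux h 0 < flux h b"
  proof (rule DERIV_pos_imp_increasing_open[OF b(1)])
    show "\<exists>y. (flux h has_real_derivative y) (at x) \<and> y > 0" if "0 < x" "x < b" for x
      using that d(2)[of x] w_pos[of x] b by (intro exI[of _ "w x * h x"] conjI deriv) auto
    show "continuous_on {0..b} (flux h)" by (rule continuous_on_subset[OF cont]) auto
  qed
  moreover have "flux h b \<le> flux h r"
  proof (rule DERIV_nonneg_imp_nondecreasing[OF b(2)])
    show "\<exists>y. (flux h has_real_derivative y) (at x) \<and> y \<ge> 0" if "b \<le> x" "x \<le> r" for x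
      using that b h(2)[of x] w_nonneg[of x] by (intro exI[of _ "w x * h x"] conjI deriv) auto
  qed
  ultimately show ?thesis using w_pos[of r] r by (simp add: slope_def)
qed

text \<open>Dominated convergence is applied twice, to the flux with bound \<open>w x * C\<close>
  and to the slope with bound \<open>C * x\<close>. Pointwise limits can thus be taken inside the
  integral equations.\<close>

lemma potential_tendsto:
  assumes h: "\<And>k. continuous_on {0..} (h k)" "continuous_on {0..} H"
    and C: "\<And>k s. s \<ge> 0 \<Longrightarrow> \<bar>h k s\<bar> \<le> C"
    and lim: "\<And>s. s \<ge> 0 \<Longrightarrow> (\<lambda>k. h k s) \<longlonglongrightarrow> H s"
  shows "(\<lambda>k. potential (h k) r) \<longlonglongrightarrow> potential H r"
proof -
  have flux: "(\<lambda>k. flux (h k) s) \<longlonglongrightarrow> flux H s" for s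
    unfolding flux_def
  proof (rule dominated_convergence(2)[where h = "\<lambda>x. w x * C"])
    show "norm (w x * h k x) \<le> w x * C" if "x \<in> {0..s}" for k x
      using that C[of x k] w_nonneg[of x] by (auto simp: abs_mult intro!: mult_left_mono)
  qed (auto intro!: flux_integrable h tendsto_intros lim)
  show ?thesis
    unfolding potential_def
  proof (rule dominated_convergence(2)[where h = "\<lambda>x. C * x"])
    show "(\<lambda>x. C * x) integrable_on {0..r}"
      by (intro integrable_continuous_real continuous_intros)
    show "norm (slope (h k) x) \<le> C * x" if "x \<in> {0..r}" for k x
      using slope_bound[of x "h k" C] C h that by auto
    show "(\<lambda>k. slope (h k) x) \<longlonglongrightarrow> slope H x" if "x \<in> {0..r}" for x
      using w_pos[of x] that by (cases "x = 0") (auto simp: slope_def intro!: tendsto_divide flux)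
  qed (auto intro!: slope_integrable h)
qed

lemma potential_Lipschitz:
  assumes "continuous_on {0..} h" "\<And>s. s \<ge> 0 \<Longrightarrow> \<bar>h s\<bar> \<le> C" "r \<in> {0..b}" "s \<in> {0..b}"
  shows "\<bar>potential h r - potential h s\<bar> \<le> C * b * \<bar>r - s\<bar>"
proof -
  have "norm (potential h r - potential h s) \<le> C * b * norm (r - s)"
  proof (rule field_differentiable_bound[of "{0..b}" "potential h" "slope h"])
    show "(potential h has_real_derivative slope h z) (at z within {0..b})" if "z \<in> {0..b}" for z
      using potential_has_derivative[OF assms(1), of z] that by (auto intro: DERIV_subset)
    show "norm (slope h z) \<le> C * b" if "z \<in> {0..b}" for z
    proof -
      have "\<bar>slope h z\<bar> \<le> C * z" using slope_bound[of z h C] assms that by auto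
      also have "\<dots> \<le> C * b"
        using that assms(2)[of 0] by (intro mult_left_mono) auto
      finally show ?thesis by simp
    qed
  qed (use assms in auto)
  then show ?thesis by simp
qed

text \<open>On \<open>{0..b}\<close> all the functions share the Lipschitz constant
  \<open>C * b\<close>, which survives a merely pointwise limit.\<close>

lemma limit_of_potentials_continuous:
  assumes h: "\<And>k. continuous_on {0..} (h k)"
    and C: "\<And>k s. s \<ge> 0 \<Longrightarrow> \<bar>h k s\<bar> \<le> C"
    and lim: "\<And>s. s \<ge> 0 \<Longrightarrow> (\<lambda>k. a k - potential (h k) s) \<longlonglongrightarrow> x s"
  shows "continuous_on {0..} x"
  unfolding continuous_on_eq_continuous_within
proof
  fix r :: real assume r: "r \<in> {0..}"
  define b where "b = r + 1"
  have "C \<ge> 0" using C[of 0] by fastforce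
  have "\<bar>x s - x t\<bar> \<le> C * b * \<bar>s - t\<bar>" if "s \<in> {0..b}" "t \<in> {0..b}" for s t
  proof (rule tendsto_upperbound)
    show "(\<lambda>k. \<bar>(a k - potential (h k) s) - (a k - potential (h k) t)\<bar>) \<longlonglongrightarrow> \<bar>x s - x t\<bar>"
      by (intro tendsto_intros lim) (use that in auto)
    have "\<bar>(a k - potential (h k) s) - (a k - potential (h k) t)\<bar> \<le> C * b * \<bar>s - t\<bar>" for k
      using potential_Lipschitz[OF h C that, of k] by (simp add: abs_minus_commute)
    then show "\<forall>\<^sub>F k in sequentially. \<bar>(a k - potential (h k) s) - (a k - potential (h k) t)\<bar> \<le> C * b * \<bar>s - t\<bar>"
      by simp
  qed auto
  then have "(C * b)-lipschitz_on {0..b} x"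
    using \<open>C \<ge> 0\<close> r by (auto simp: lipschitz_on_def dist_real_def b_def)
  then have "continuous (at r within {0..b}) x"
    using lipschitz_on_continuous_on[of _ "{0..b}" x] r
    by (auto simp: continuous_on_eq_continuous_within b_def)
  moreover have "at r within {0..b} = at r within {0..}"
    by (rule at_within_nhd[of _ "{..<r+1}"]) (auto simp: b_def)
  ultimately show "continuous (at r within {0..}) x"
    by (simp add: continuous_within)
qed

end

subsection \<open>Existence and comparison for the truncated system\<close>

lemma tendsto_pos_power:
  assumes "q > 0" "(f \<longlongrightarrow> a) F"
  shows "((\<lambda>x. pos_power q (f x)) \<longlongrightarrow> pos_power q a) F"
proof -
  have "isCont (pos_power q) a"
    using continuous_on_pos_power[OF assms(1), of UNIV id]
    by (simp add: continuous_on_eq_continuous_at)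
  then show ?thesis using assms(2) by (rule isCont_tendsto_compose)
qed

text \<open>The zeros in \<open>{0..b}\<close> form a nonempty compact set, whose least element is
  \<open>m\<close>; a nonpositive value before \<open>m\<close> would produce an earlier zero by the
  intermediate value theorem.\<close>

lemma first_zero:
  fixes f :: "real \<Rightarrow> real"
  assumes f: "continuous_on {0..} f" "f 0 > 0" "f b \<le> 0" "b \<ge> 0"
  obtains m where "0 < m" "m \<le> b" "f m = 0" "\<And>t. 0 \<le> t \<Longrightarrow> t < m \<Longrightarrow> f t > 0"
proof -
  have sub: "continuous_on {0..c} f" for c by (rule continuous_on_subset[OF f(1)]) auto
  define S where "S = {x\<in>{0..b}. f x = 0}"
  have "\<exists>x\<ge>0. x \<le> b \<and> f x = 0" using f sub by (intro IVT2') auto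
  then have "S \<noteq> {}" by (auto simp: S_def)
  moreover have "compact S"
    unfolding S_def using continuous_closed_preimage_constant[OF sub, of b 0]
    by (auto simp: compact_eq_bounded_closed intro: bounded_subset[of "{0..b}"])
  ultimately obtain m where m: "m \<in> S" "\<And>x. x \<in> S \<Longrightarrow> m \<le> x"
    using compact_attains_inf by metis
  show ?thesis
  proof
    show "f m = 0" "m \<le> b" using m by (auto simp: S_def)
    then show "0 < m" using m f(2) by (cases "m = 0") (auto simp: S_def)
    show "f t > 0" if "0 \<le> t" "t < m" for t
    proof (rule ccontr)
      assume "\<not> f t > 0"
      then have "\<exists>x\<ge>0. x \<le> t \<and> f x = 0" using f sub that by (intro IVT2') auto
      then show False using m that by (force simp: S_def)
    qed
  qed
qed

context radial_weight
begin

text \<open>Truncating the nonlinearities at \<open>0\<close> makes every solution exist on all of \<open>[0,\<infinity>)\<close>,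
  possibly with negative values.\<close>

definition solution ::
    "real \<Rightarrow> real \<Rightarrow> real \<Rightarrow> real \<Rightarrow> (real \<Rightarrow> real) \<Rightarrow> (real \<Rightarrow> real) \<Rightarrow> bool" where
  "solution q p \<xi> \<eta> u v \<longleftrightarrow> continuous_on {0..} u \<and> continuous_on {0..} v \<and>
     (\<forall>r\<ge>0. u r = \<xi> - potential (\<lambda>s. pos_power q (v s)) r) \<and>
     (\<forall>r\<ge>0. v r = \<eta> - potential (\<lambda>s. pos_power p (u s)) r)"

text \<open>This symmetry lets facts about one component, or about one kind of crossing, be
  transferred to the other.\<close>

lemma solution_swap: "solution q p \<xi> \<eta> u v \<longleftrightarrow> solution p q \<eta> \<xi> v u"
  by (auto simp: solution_def)

lemma solutionD:
  assumes "solution q p \<xi> \<eta> u v"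
  shows "continuous_on {0..} u" "continuous_on {0..} v" "u 0 = \<xi>" "v 0 = \<eta>"
    "r \<ge> 0 \<Longrightarrow> u r = \<xi> - potential (\<lambda>s. pos_power q (v s)) r"
    "r \<ge> 0 \<Longrightarrow> v r = \<eta> - potential (\<lambda>s. pos_power p (u s)) r"
  using assms by (auto simp: solution_def)

lemma potential_nonneg:
  "continuous_on {0..} h \<Longrightarrow> (\<And>s. s \<in> {0..r} \<Longrightarrow> 0 \<le> h s) \<Longrightarrow> 0 \<le> potential h r"
  using potential_mono[of "\<lambda>_. 0" h r] by (simp add: potential_def slope_def[abs_def] flux_def)

lemma potential_add:
  assumes "continuous_on {0..} h" "continuous_on {0..} k"
  shows "potential (\<lambda>s. h s + k s) r = potential h r + potential k r"
proof -
  have "flux (\<lambda>s. h s + k s) x = flux h x + flux k x" for x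
    unfolding flux_def distrib_left by (intro integral_add flux_integrable assms)
  then have "slope (\<lambda>s. h s + k s) = (\<lambda>x. slope h x + slope k x)"
    by (auto simp: slope_def add_divide_distrib)
  then show ?thesis
    unfolding potential_def by (simp add: integral_add slope_integrable assms)
qed

lemma potential_cmult: "potential (\<lambda>s. c * h s) r = c * potential h r"
  unfolding potential_def slope_def[abs_def] flux_def
  by (simp add: mult.left_commute[of _ c] flip: times_divide_eq_right)

lemma potential_const: "potential (\<lambda>s. c) r = c * potential (\<lambda>_. 1) r"
  using potential_cmult[of c "\<lambda>_. 1"] by simp

text \<open>Monotonicity of \<open>w\<close> gives
  \<open>flux g s \<le> w s * integral {0..s} g\<close>, so the weight cancels in the slope. The
  iterated integral becomes a single one, the form that Gronwall's argument requires.\<close>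

lemma potential_le_integral:
  assumes g: "continuous_on {0..} g" "\<And>s. s \<in> {0..R} \<Longrightarrow> 0 \<le> g s" and r: "0 \<le> r" "r \<le> R"
  shows "potential g r \<le> R * integral {0..r} g"
proof -
  have int: "g integrable_on {a..b}" if "a \<ge> 0" for a b
    using that by (intro integrable_continuous_real continuous_on_subset[OF g(1)]) auto
  have "slope g s \<le> integral {0..r} g" if "s \<in> {0..r}" for s
  proof (cases "s = 0")
    case True
    then show ?thesis using g r by (auto intro!: integral_nonneg int)
  next
    case False
    have "flux g s \<le> integral {0..s} (\<lambda>x. w s * g x)"
      unfolding flux_def using that r g
      by (intro integral_le flux_integrable integrable_on_mult_right int)
        (auto intro!: mult_right_mono w_mono)
    also have "\<dots> = w s * integral {0..s} g" by simp
    also have "\<dots> \<le> w s * integral {0..r} g"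
      using that r g by (intro mult_left_mono w_nonneg integral_subset_le int) auto
    finally show ?thesis
      using False that w_pos[of s] by (simp add: slope_def field_simps)
  qed
  then have "potential g r \<le> integral {0..r} (\<lambda>_. integral {0..r} g)"
    unfolding potential_def using g r by (intro integral_le slope_integrable) auto
  also have "\<dots> = r * integral {0..r} g" using r by simp
  also have "\<dots> \<le> R * integral {0..r} g"
    using r g by (intro mult_right_mono integral_nonneg int) auto
  finally show ?thesis .
qed

text \<open>Upper bounds on \<open>U\<close> and \<open>V\<close> bound the truncated powers, hence
  the potentials, hence also the sequences from below; monotone sequences then converge. The shift
  is \<open>m = 1\<close> for the iteration that constructs solutions and \<open>m = 0\<close> for
  limits of solutions with varying data.\<close>

lemma monotone_limit:
  fixes U V :: "nat \<Rightarrow> real \<Rightarrow> real"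
  assumes qp: "q > 0" "p > 0"
    and cont: "\<And>k. continuous_on {0..} (U k)" "\<And>k. continuous_on {0..} (V k)"
    and U: "\<And>k r. r \<ge> 0 \<Longrightarrow> U (k + m) r = a k - potential (\<lambda>s. pos_power q (V k s)) r"
    and V: "\<And>k r. r \<ge> 0 \<Longrightarrow> V k r = b k - potential (\<lambda>s. pos_power p (U k s)) r"
    and mono: "\<And>r. r \<ge> 0 \<Longrightarrow> monoseq (\<lambda>k. U k r)" "\<And>r. r \<ge> 0 \<Longrightarrow> monoseq (\<lambda>k. V k r)"
    and lim: "a \<longlonglongrightarrow> \<xi>" "b \<longlonglongrightarrow> \<eta>"
    and bound: "\<And>k r. r \<ge> 0 \<Longrightarrow> U k r \<le> B" "\<And>k r. r \<ge> 0 \<Longrightarrow> V k r \<le> B"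
  obtains u v where "solution q p \<xi> \<eta> u v"
    "\<And>r. r \<ge> 0 \<Longrightarrow> (\<lambda>k. U k r) \<longlonglongrightarrow> u r" "\<And>r. r \<ge> 0 \<Longrightarrow> (\<lambda>k. V k r) \<longlonglongrightarrow> v r"
proof -
  note [continuous_intros] = cont
  have C: "\<bar>pos_power q (V k s)\<bar> \<le> pos_power q B" "\<bar>pos_power p (U k s)\<bar> \<le> pos_power p B"
    if "s \<ge> 0" for k s
    using that bound[of s k] qp by (auto simp: pos_power_nonneg intro: pos_power_mono)
  have bounded: "Bseq (\<lambda>k. c k - potential (h k) r)"
    if c: "convergent c" "r \<ge> 0" "\<And>k. continuous_on {0..} (h k)" "\<And>k s. s \<ge> 0 \<Longrightarrow> \<bar>h k s\<bar> \<le> D"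
    for c r h and D :: real
  proof -
    obtain K where K: "\<And>k. \<bar>c k\<bar> \<le> K"
      using convergent_imp_Bseq[OF c(1)] by (auto simp: Bseq_def)
    have "\<bar>potential (h k) r\<bar> \<le> D * r * r" for k
      using potential_Lipschitz[OF that(3,4), of r r 0 k] that(2) by auto
    then have "norm (c k - potential (h k) r) \<le> K + D * r * r" for k
      using K[of k] by (smt (verit) real_norm_def)
    then show ?thesis by (rule BseqI')
  qed
  have "Bseq (\<lambda>k. U (k + m) r)" if "r \<ge> 0" for r
    using bounded[of a r "\<lambda>k s. pos_power q (V k s)" "pos_power q B"] U that C lim
    by (auto intro!: continuous_intros qp simp: convergent_def)
  then have "Bseq (\<lambda>k. U k r)" if "r \<ge> 0" for r
    using that Bseq_offset[of "\<lambda>k. U k r" m] by simp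
  then have "convergent (\<lambda>k. U k r)" if "r \<ge> 0" for r
    using that by (intro Bseq_monoseq_convergent mono)
  then obtain u where u: "\<And>r. r \<ge> 0 \<Longrightarrow> (\<lambda>k. U k r) \<longlonglongrightarrow> u r"
    unfolding convergent_def by metis
  have "Bseq (\<lambda>k. V k r)" if "r \<ge> 0" for r
    using bounded[of b r "\<lambda>k s. pos_power p (U k s)" "pos_power p B"] V that C lim
    by (auto intro!: continuous_intros qp simp: convergent_def)
  then have "convergent (\<lambda>k. V k r)" if "r \<ge> 0" for r
    using that by (intro Bseq_monoseq_convergent mono)
  then obtain v where v: "\<And>r. r \<ge> 0 \<Longrightarrow> (\<lambda>k. V k r) \<longlonglongrightarrow> v r"
    unfolding convergent_def by metis
  have U_lim: "(\<lambda>k. a k - potential (\<lambda>s. pos_power q (V k s)) r) \<longlonglongrightarrow> u r" if "r \<ge> 0" for r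
    using LIMSEQ_ignore_initial_segment[OF u[OF that], of m] U[OF that] by simp
  have V_lim: "(\<lambda>k. b k - potential (\<lambda>s. pos_power p (U k s)) r) \<longlonglongrightarrow> v r" if "r \<ge> 0" for r
    using v[OF that] V[OF that] by simp
  have cu: "continuous_on {0..} u"
    by (rule limit_of_potentials_continuous[OF _ C(1) U_lim]) (auto intro!: continuous_intros qp)
  have cv: "continuous_on {0..} v"
    by (rule limit_of_potentials_continuous[OF _ C(2) V_lim]) (auto intro!: continuous_intros qp)
  have "u r = \<xi> - potential (\<lambda>s. pos_power q (v s)) r" if "r \<ge> 0" for r
    by (rule LIMSEQ_unique[OF U_lim[OF that]], rule tendsto_diff[OF lim(1)],
        rule potential_tendsto[OF _ _ C(1)])
      (auto intro!: continuous_intros qp cu cv tendsto_pos_power v)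
  moreover have "v r = \<eta> - potential (\<lambda>s. pos_power p (u s)) r" if "r \<ge> 0" for r
    by (rule LIMSEQ_unique[OF V_lim[OF that]], rule tendsto_diff[OF lim(2)],
        rule potential_tendsto[OF _ _ C(2)])
      (auto intro!: continuous_intros qp cu cv tendsto_pos_power u)
  ultimately have "solution q p \<xi> \<eta> u v" using cu cv by (auto simp: solution_def)
  then show ?thesis using that u v by blast
qed

text \<open>The system is competitive, so \<open>u \<mapsto> v \<mapsto> u\<close> is monotone and iterating it downwards from
  \<open>u = \<xi>\<close> converges; no Lipschitz condition is needed, which matters when \<open>p < 1\<close> or \<open>q < 1\<close>.\<close>

lemma solution_exists:
  assumes qp: "q > 0" "p > 0"
  obtains u v where "solution q p \<xi> \<eta> u v"
proof -
  define next_v where "next_v U r = \<eta> - potential (\<lambda>s. pos_power p (U s)) r" for U r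
  define next_u where "next_u V r = \<xi> - potential (\<lambda>s. pos_power q (V s)) r" for V r
  define U where "U k = ((next_u \<circ> next_v) ^^ k) (\<lambda>_. \<xi>)" for k
  define V where "V k = next_v (U k)" for k
  have U_Suc: "U (Suc k) = next_u (V k)" for k by (simp add: U_def V_def)
  have c_next: "continuous_on {0..} (next_v f)" "continuous_on {0..} (next_u f)"
    if "continuous_on {0..} f" for f
    unfolding next_v_def next_u_def
    by (intro continuous_intros potential_continuous qp that)+
  have cU: "continuous_on {0..} (U k)" for k
  proof (induction k)
    case (Suc k)
    then show ?case unfolding U_Suc V_def by (intro c_next)
  qed (simp add: U_def)
  have cV: "continuous_on {0..} (V k)" for k unfolding V_def by (intro c_next cU)
  have U_le: "U k r \<le> \<xi>" if "r \<ge> 0" for k r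
    using that by (cases k)
      (auto simp: U_def[of 0] U_Suc next_u_def intro!: potential_nonneg continuous_intros cV qp pos_power_nonneg)
  have V_le: "V k r \<le> \<eta>" if "r \<ge> 0" for k r
    using that
    by (auto simp: V_def next_v_def intro!: potential_nonneg continuous_intros cU qp pos_power_nonneg)
  have V_mono: "V k r \<le> V (Suc k) r" if "\<And>r. r \<ge> 0 \<Longrightarrow> U (Suc k) r \<le> U k r" "r \<ge> 0" for k r
    using that unfolding V_def next_v_def
    by (intro diff_left_mono potential_mono continuous_intros cU qp pos_power_mono) auto
  have U_mono: "U (Suc k) r \<le> U k r" if "r \<ge> 0" for k r
    using that
  proof (induction k arbitrary: r)
    case 0
    then show ?case using U_le[of r "Suc 0"] by (simp add: U_def[of 0])
  next
    case (Suc k)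
    then show ?case using V_mono[of k]
      unfolding U_Suc[of "Suc k"] U_Suc[of k] next_u_def
      by (intro diff_left_mono potential_mono continuous_intros cV qp pos_power_mono) auto
  qed
  have "monoseq (\<lambda>k. U k r)" "monoseq (\<lambda>k. V k r)" if "r \<ge> 0" for r
    using that U_mono V_mono by (auto simp: monoseq_Suc)
  moreover have "U k r \<le> max \<xi> \<eta>" "V k r \<le> max \<xi> \<eta>" if "r \<ge> 0" for k r
    using U_le V_le that by (auto simp: le_max_iff_disj)
  ultimately show ?thesis
    using qp cU cV
    by (intro monotone_limit[of q p U V 1 "\<lambda>_. \<xi>" "\<lambda>_. \<eta>" \<xi> \<eta> "max \<xi> \<eta>", OF _ _ _ _ _ _ _ _ _ _ _ _ that])
      (simp_all add: U_Suc next_u_def, simp_all add: V_def next_v_def)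
qed

section \<open>Comparison and monotonicity of solutions\<close>

lemma solution_le:
  assumes s: "solution q p \<xi> \<eta> u v" "q > 0" "p > 0" "r \<ge> 0"
  shows "u r \<le> \<xi>" "v r \<le> \<eta>"
  using solutionD[OF s(1)] s(2-)
  by (auto intro!: potential_nonneg continuous_intros pos_power_nonneg)

text \<open>As long as \<open>v1 \<le> v2\<close>, the first equation gives
  \<open>u2 \<le> u1\<close>, and the second then gives
  \<open>v2 - v1 \<ge> \<eta>2 - \<eta>1 > 0\<close>. Hence \<open>v2 - v1\<close> cannot have a
  first zero, and the ordering never breaks.\<close>

lemma solution_compare:
  assumes s1: "solution q p \<xi>1 \<eta>1 u1 v1" and s2: "solution q p \<xi>2 \<eta>2 u2 v2"
    and qp: "q > 0" "p > 0" and le: "\<xi>2 \<le> \<xi>1" "\<eta>1 < \<eta>2" and r: "r \<ge> 0"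
  shows "\<eta>2 - \<eta>1 \<le> v2 r - v1 r" "u2 r \<le> u1 r"
proof -
  note [continuous_intros] = solutionD(1,2)[OF s1] solutionD(1,2)[OF s2]
  have u: "u2 t \<le> u1 t" if "t \<ge> 0" "\<And>s. s \<in> {0..t} \<Longrightarrow> v1 s \<le> v2 s" for t
  proof -
    have "potential (\<lambda>s. pos_power q (v1 s)) t \<le> potential (\<lambda>s. pos_power q (v2 s)) t"
      using that by (intro potential_mono continuous_intros qp pos_power_mono) auto
    then show ?thesis
      using solutionD(5)[OF s1, of t] solutionD(5)[OF s2, of t] that le by linarith
  qed
  have v: "\<eta>2 - \<eta>1 \<le> v2 t - v1 t" if "t \<ge> 0" "\<And>s. s \<in> {0..t} \<Longrightarrow> v1 s \<le> v2 s" for t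
  proof -
    have "potential (\<lambda>s. pos_power p (u2 s)) t \<le> potential (\<lambda>s. pos_power p (u1 s)) t"
      using that by (intro potential_mono continuous_intros qp pos_power_mono u) auto
    then show ?thesis
      using solutionD(6)[OF s1, of t] solutionD(6)[OF s2, of t] that le by linarith
  qed
  have less: "v1 t < v2 t" if "t \<ge> 0" for t
  proof (rule ccontr)
    assume "\<not> v1 t < v2 t"
    then have "v2 t - v1 t \<le> 0" by simp
    moreover have "continuous_on {0..} (\<lambda>t. v2 t - v1 t)" by (intro continuous_intros)
    moreover have "v2 0 - v1 0 > 0" using le solutionD(4)[OF s1] solutionD(4)[OF s2] by simp
    ultimately obtain m where m: "0 < m" "v2 m - v1 m = 0"
        "\<And>t. 0 \<le> t \<Longrightarrow> t < m \<Longrightarrow> v2 t - v1 t > 0"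
      using first_zero[of "\<lambda>t. v2 t - v1 t" t] \<open>t \<ge> 0\<close> by metis
    have "v1 s \<le> v2 s" if "s \<in> {0..m}" for s
      using m(2) m(3)[of s] that by (cases "s = m") auto
    then show False using v[of m] m le by simp
  qed
  show "\<eta>2 - \<eta>1 \<le> v2 r - v1 r" "u2 r \<le> u1 r"
    using less by (intro u v r less_imp_le; force)+
qed

lemma solution_has_derivative:
  assumes s: "solution q p \<xi> \<eta> u v" "q > 0" "p > 0" "r \<ge> 0"
  shows "(u has_real_derivative - slope (\<lambda>s. pos_power q (v s)) r) (at r within {0..})"
    "(v has_real_derivative - slope (\<lambda>s. pos_power p (u s)) r) (at r within {0..})"
proof -
  note D = solutionD[OF s(1)]
  have *: "((\<lambda>r. c - potential h r) has_real_derivative - slope h r) (at r within {0..})"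
    if "continuous_on {0..} h" for c h
    using potential_has_derivative[OF that s(4)]
    by (auto intro!: derivative_eq_intros)
  show "(u has_real_derivative - slope (\<lambda>s. pos_power q (v s)) r) (at r within {0..})"
    by (rule has_field_derivative_transform_within[OF *[of "\<lambda>s. pos_power q (v s)" \<xi>] zero_less_one])
      (use s D in \<open>auto intro!: continuous_intros\<close>)
  show "(v has_real_derivative - slope (\<lambda>s. pos_power p (u s)) r) (at r within {0..})"
    by (rule has_field_derivative_transform_within[OF *[of "\<lambda>s. pos_power p (u s)" \<eta>] zero_less_one])
      (use s D in \<open>auto intro!: continuous_intros\<close>)
qed

lemma solution_slope_pos:
  assumes s: "solution q p \<xi> \<eta> u v" "q > 0" "p > 0" and "\<eta> > 0" "r > 0"
  shows "slope (\<lambda>s. pos_power q (v s)) r > 0"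
  using assms solutionD[OF s(1)]
  by (intro slope_pos continuous_intros) (auto intro: pos_power_nonneg pos_power_pos)

text \<open>Truncated powers are nonnegative everywhere and positive at the pole, so the slopes stay
  positive even after a component has become negative.\<close>

lemma solution_decreasing:
  assumes s: "solution q p \<xi> \<eta> u v" "q > 0" "p > 0" and "\<xi> > 0" "\<eta> > 0" "0 \<le> r" "r < t"
  shows "u t < u r" "v t < v r"
proof -
  show "u t < u r"
    using solution_has_derivative(1)[OF s] solution_slope_pos[OF s] assms
    by (intro strictly_decreasing_from_derivative_halfline[of u "\<lambda>r. - slope (\<lambda>s. pos_power q (v s)) r"]) auto
  show "v t < v r"
    using solution_has_derivative(2)[OF s] solution_slope_pos[OF s(1)[unfolded solution_swap[of q]]] assms
    by (intro strictly_decreasing_from_derivative_halfline[of v "\<lambda>r. - slope (\<lambda>s. pos_power p (u s)) r"]) auto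
qed

end

subsection \<open>Uniqueness and the Pohozaev identity\<close>

lemma pos_power_has_derivative:
  assumes "x > 0"
  shows "(pos_power (q + 1) has_real_derivative (q + 1) * pos_power q x) (at x)"
proof -
  have "((\<lambda>x. x powr (q + 1)) has_real_derivative (q + 1) * pos_power q x) (at x)"
    using has_real_derivative_powr[OF assms, of "q + 1"] assms by (simp add: pos_power_def)
  then show ?thesis
    by (rule has_field_derivative_transform_within_open[of _ _ _ "{0<..}"])
      (use assms in \<open>auto simp: pos_power_def\<close>)
qed

lemma pos_power_add_1: "x > 0 \<Longrightarrow> pos_power (q + 1) x = pos_power q x * x"
  by (simp add: pos_power_def powr_add)

context radial_weight
begin

text \<open>Gronwall: near zero values \<open>pos_power\<close> is not Lipschitz, hence the positivity assumptions.\<close>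

lemma solution_unique_while_positive:
  assumes s1: "solution q p \<xi> \<eta> u1 v1" and s2: "solution q p \<xi> \<eta> u2 v2"
    and qp: "q > 0" "p > 0" and data: "\<xi> > 0" "\<eta> > 0"
    and pos: "u1 R > 0" "v1 R > 0" "u2 R > 0" "v2 R > 0" and r: "r \<in> {0..R}"
  shows "u1 r = u2 r \<and> v1 r = v2 r"
proof -
  note D1 = solutionD[OF s1] and D2 = solutionD[OF s2]
  note [continuous_intros] = D1(1,2) D2(1,2)
  \<comment> \<open>Components decrease, so their values at \<open>R\<close> are their minima on
    \<open>{0..R}\<close>, and the initial data are their maxima: all four functions take values in
    \<open>{\<epsilon>..b}\<close>.\<close>
  define \<epsilon> where "\<epsilon> = Min {u1 R, v1 R, u2 R, v2 R}"
  define b where "b = max \<xi> \<eta>"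
  have "\<epsilon> > 0" using pos by (auto simp: \<epsilon>_def)
  have dec: "u1 R \<le> u1 s" "v1 R \<le> v1 s" "u2 R \<le> u2 s" "v2 R \<le> v2 s" if "s \<in> {0..R}" for s
    using that solution_decreasing[OF s1 qp data, of s R] solution_decreasing[OF s2 qp data, of s R]
    by (cases "s = R"; auto)+
  have range: "u1 s \<in> {\<epsilon>..b}" "v1 s \<in> {\<epsilon>..b}" "u2 s \<in> {\<epsilon>..b}" "v2 s \<in> {\<epsilon>..b}"
    if "s \<in> {0..R}" for s
    using that dec[OF that] solution_le[OF s1 qp, of s] solution_le[OF s2 qp, of s]
    by (auto simp: \<epsilon>_def b_def min_le_iff_disj le_max_iff_disj)
  obtain Lq where Lq: "Lq > 0"
    "\<And>x y. x \<in> {\<epsilon>..b} \<Longrightarrow> y \<in> {\<epsilon>..b} \<Longrightarrow> \<bar>pos_power q x - pos_power q y\<bar> \<le> Lq * \<bar>x - y\<bar>"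
    using pos_power_Lipschitz[OF \<open>\<epsilon> > 0\<close>] by blast
  obtain Lp where Lp: "Lp > 0"
    "\<And>x y. x \<in> {\<epsilon>..b} \<Longrightarrow> y \<in> {\<epsilon>..b} \<Longrightarrow> \<bar>pos_power p x - pos_power p y\<bar> \<le> Lp * \<bar>x - y\<bar>"
    using pos_power_Lipschitz[OF \<open>\<epsilon> > 0\<close>] by blast
  define D where "D s = \<bar>u1 s - u2 s\<bar> + \<bar>v1 s - v2 s\<bar>" for s
  define I where "I s = integral {0..s} D" for s
  define K where "K = (Lq + Lp) * R"
  have cD: "continuous_on {0..} D" unfolding D_def by (intro continuous_intros)
  have pot: "potential h s \<le> potential k s + L * R * I s"
    if "L > 0" "continuous_on {0..} h" "continuous_on {0..} k" "s \<in> {0..R}"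
      "\<And>t. t \<in> {0..R} \<Longrightarrow> h t \<le> k t + L * D t" for h k s L
  proof -
    have "potential h s \<le> potential (\<lambda>t. k t + L * D t) s"
      using that by (intro potential_mono continuous_intros cD) auto
    also have "\<dots> = potential k s + L * potential D s"
      using that cD by (subst potential_add) (auto intro!: continuous_intros simp: potential_cmult)
    also have "potential D s \<le> R * I s"
      unfolding I_def using that cD by (intro potential_le_integral) (auto simp: D_def)
    finally show ?thesis using that by (simp add: mult.assoc)
  qed
  have D_le: "D s \<le> K * I s" if "s \<in> {0..R}" for s
  proof -
    have q: "\<bar>pos_power q (v1 t) - pos_power q (v2 t)\<bar> \<le> Lq * D t" if "t \<in> {0..R}" for t
    proof -
      have "\<bar>pos_power q (v1 t) - pos_power q (v2 t)\<bar> \<le> Lq * \<bar>v1 t - v2 t\<bar>"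
        using Lq(2) range[OF that] by blast
      also have "\<dots> \<le> Lq * D t" using Lq(1) by (auto simp: D_def)
      finally show ?thesis .
    qed
    have p: "\<bar>pos_power p (u1 t) - pos_power p (u2 t)\<bar> \<le> Lp * D t" if "t \<in> {0..R}" for t
    proof -
      have "\<bar>pos_power p (u1 t) - pos_power p (u2 t)\<bar> \<le> Lp * \<bar>u1 t - u2 t\<bar>"
        using Lp(2) range[OF that] by blast
      also have "\<dots> \<le> Lp * D t" using Lp(1) by (auto simp: D_def)
      finally show ?thesis .
    qed
    have "potential (\<lambda>t. pos_power q (v1 t)) s \<le> potential (\<lambda>t. pos_power q (v2 t)) s + Lq * R * I s"
      "potential (\<lambda>t. pos_power q (v2 t)) s \<le> potential (\<lambda>t. pos_power q (v1 t)) s + Lq * R * I s"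
      using that q by (intro pot Lq continuous_intros qp; fastforce simp: abs_le_iff)+
    moreover
    have "potential (\<lambda>t. pos_power p (u1 t)) s \<le> potential (\<lambda>t. pos_power p (u2 t)) s + Lp * R * I s"
      "potential (\<lambda>t. pos_power p (u2 t)) s \<le> potential (\<lambda>t. pos_power p (u1 t)) s + Lp * R * I s"
      using that p by (intro pot Lp continuous_intros qp; fastforce simp: abs_le_iff)+
    ultimately have "\<bar>u1 s - u2 s\<bar> \<le> Lq * R * I s" "\<bar>v1 s - v2 s\<bar> \<le> Lp * R * I s"
      using D1(5,6)[of s] D2(5,6)[of s] that by auto
    then show ?thesis by (simp add: D_def K_def algebra_simps)
  qed
  \<comment> \<open>Integrating factor: \<open>I' = D \<le> K * I\<close> makes
    \<open>I x * exp (- K * x)\<close> nonincreasing, and it starts at \<open>0\<close>.\<close>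
  have "I r * exp (- K * r) \<le> I 0 * exp (- K * 0)"
  proof (cases "r = 0")
    case False
    then have "0 < r" using r by auto
    have dI: "(I has_real_derivative D x) (at x within {0..})" if "x \<ge> 0" for x
      unfolding I_def[abs_def] using that cD by (intro integral_has_real_derivative_halfline)
    show ?thesis
    proof (rule DERIV_nonpos_imp_decreasing_open[of 0 r "\<lambda>x. I x * exp (- K * x)"])
      show "\<exists>y. ((\<lambda>x. I x * exp (- K * x)) has_real_derivative y) (at x) \<and> y \<le> 0"
        if "0 < x" "x < r" for x
      proof (intro exI conjI)
        show "((\<lambda>x. I x * exp (- K * x)) has_real_derivative (D x - K * I x) * exp (- K * x)) (at x)"
          using dI[of x] that by (auto intro!: derivative_eq_intros simp: at_within_halfline algebra_simps)
        show "(D x - K * I x) * exp (- K * x) \<le> 0"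
          using D_le[of x] that r by (intro mult_nonpos_nonneg) auto
      qed
      have "continuous_on {0..} I" using dI by (auto intro!: DERIV_continuous_on)
      then show "continuous_on {0..r} (\<lambda>x. I x * exp (- K * x))"
        by (intro continuous_intros) (auto intro: continuous_on_subset)
    qed (use \<open>0 < r\<close> in auto)
  qed auto
  then have "I r \<le> 0" by (auto simp: I_def mult_le_0_iff not_le[symmetric])
  moreover have "K \<ge> 0" using Lq Lp r by (auto simp: K_def)
  ultimately have "D r \<le> 0" using D_le[OF r] mult_nonneg_nonpos[of K "I r"] by linarith
  then show ?thesis by (auto simp: D_def)
qed

text \<open>\<open>P\<close> is \<open>\<Phi>\<close> times the energy \<open>u' v' + v\<^bsup>q+1\<^esup>/(q+1) + u\<^bsup>p+1\<^esup>/(p+1)\<close>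
  plus \<open>w (u' v/(q+1) + u v'/(p+1))\<close>. These coefficients cancel the powers of \<open>u\<close> and \<open>v\<close> in \<open>P'\<close>,
  which leaves \<open>u' v'\<close> times a factor that \<open>crit\<close> makes nonpositive.\<close>

lemma pohozaev:
  assumes s: "solution q p \<xi> \<eta> u v" and qp: "q > 0" "p > 0" and data: "\<xi> > 0" "\<eta> > 0"
    and crit: "\<And>r. r > 0 \<Longrightarrow> (1 + 1 / (p + 1) + 1 / (q + 1)) * (w r)\<^sup>2 \<le> 2 * flux (\<lambda>_. 1) r * w' r"
    and zero: "u R = 0" "v R = 0" and R: "R > 0"
  shows False
proof -
  note SD = solutionD[OF s]
  note [continuous_intros] = SD(1,2)
  define h where "h r = pos_power q (v r)" for r
  define k where "k r = pos_power p (u r)" for r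
  have ch: "continuous_on {0..} h" and ck: "continuous_on {0..} k"
    unfolding h_def k_def by (intro continuous_intros qp)+
  \<comment> \<open>Along the solution \<open>a = - u'\<close> and \<open>b = - v'\<close>, so
    \<open>flux h = - w u'\<close> and \<open>flux k = - w v'\<close>.\<close>
  define a where "a = slope h"
  define b where "b = slope k"
  define \<Phi> where "\<Phi> = flux (\<lambda>_. 1)"
  define \<alpha> where "\<alpha> = 1 / (q + 1)"
  define \<beta> where "\<beta> = 1 / (p + 1)"
  define P where "P r = \<Phi> r * (a r * b r + \<alpha> * pos_power (q + 1) (v r) + \<beta> * pos_power (p + 1) (u r))
     - (\<alpha> * flux h r * v r + \<beta> * u r * flux k r)" for r
  have flux_cont: "continuous_on {0..} (flux f)" if "continuous_on {0..} f" for f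
    using flux_has_derivative[OF that] by (auto intro!: DERIV_continuous_on)
  have "continuous_on {0..} P"
    unfolding P_def \<Phi>_def a_def b_def
    by (intro continuous_intros flux_cont slope_continuous ch ck) (use qp in auto)
  then have cont: "continuous_on {0..R} P" by (rule continuous_on_subset) auto
  have "P R \<le> P 0"
  proof (rule DERIV_nonpos_imp_decreasing_open[OF less_imp_le[OF R] _ cont])
    fix x assume x: "0 < x" "x < R"
    \<comment> \<open>Both components decrease strictly to \<open>0\<close> at \<open>R\<close>;
      positivity before \<open>R\<close> makes the powers differentiable.\<close>
    have pos: "u x > 0" "v x > 0"
      using solution_decreasing[OF s qp data, of x R] x zero by auto
    have a': "(a has_real_derivative h x - w' x * a x / w x) (at x)"
      unfolding a_def using x by (intro slope_has_derivative ch)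
    have b': "(b has_real_derivative k x - w' x * b x / w x) (at x)"
      unfolding b_def using x by (intro slope_has_derivative ck)
    have u': "(u has_real_derivative - a x) (at x)" and v': "(v has_real_derivative - b x) (at x)"
      using solution_has_derivative[OF s qp, of x] x
      by (auto simp: a_def b_def h_def[abs_def] k_def[abs_def] at_within_halfline)
    have pv: "((\<lambda>x. pos_power (q + 1) (v x)) has_real_derivative (q + 1) * pos_power q (v x) * - b x) (at x)"
      by (rule DERIV_chain2[OF pos_power_has_derivative v']) (use pos in auto)
    have pu: "((\<lambda>x. pos_power (p + 1) (u x)) has_real_derivative (p + 1) * pos_power p (u x) * - a x) (at x)"
      by (rule DERIV_chain2[OF pos_power_has_derivative u']) (use pos in auto)
    have fl: "(flux f has_real_derivative w x * f x) (at x)" if "continuous_on {0..} f" for f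
      using flux_has_derivative[OF that, of x] x by (auto simp: at_within_halfline)
    have \<Phi>': "(\<Phi> has_real_derivative w x) (at x)"
      using fl[of "\<lambda>_. 1"] by (simp add: \<Phi>_def)
    have wx: "w x > 0" using w_pos x by auto
    have ab: "a x > 0" "b x > 0"
      using solution_slope_pos[OF s qp] solution_slope_pos[OF s[unfolded solution_swap[of q]]] data x qp
      by (auto simp: a_def b_def h_def[abs_def] k_def[abs_def])
    have A: "flux h x = w x * a x" "flux k x = w x * b x"
      using wx by (auto simp: a_def b_def slope_def)
    define P' where "P' =
       w x * (a x * b x + \<alpha> * pos_power (q + 1) (v x) + \<beta> * pos_power (p + 1) (u x))
       + \<Phi> x * ((h x - w' x * a x / w x) * b x + a x * (k x - w' x * b x / w x)
           + \<alpha> * ((q + 1) * h x * - b x) + \<beta> * ((p + 1) * k x * - a x))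
       - (\<alpha> * (w x * h x * v x + flux h x * - b x) + \<beta> * (- a x * flux k x + u x * (w x * k x)))"
    have "(P has_real_derivative P') (at x)"
      unfolding P_def[abs_def] P'_def
      by (rule derivative_eq_intros refl a' b' u' v' pv pu fl ch ck \<Phi>')+
        (simp add: h_def k_def algebra_simps)
    moreover have "P' \<le> 0"
    proof -
      have "\<alpha> * (q + 1) = 1" "\<beta> * (p + 1) = 1" using qp by (auto simp: \<alpha>_def \<beta>_def)
      then have *: "\<alpha> * ((q + 1) * h x * - b x) = - (h x * b x)"
          "\<beta> * ((p + 1) * k x * - a x) = - (k x * a x)"
        by (simp_all flip: mult.assoc)
      have "P' = a x * b x / w x * ((1 + \<beta> + \<alpha>) * (w x)\<^sup>2 - 2 * \<Phi> x * w' x)"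
        unfolding P'_def * A pos_power_add_1[OF pos(1)] pos_power_add_1[OF pos(2)] using wx
        by (simp add: field_simps h_def k_def power2_eq_square)
      also have "\<dots> \<le> 0"
        using crit[of x] x ab wx unfolding \<alpha>_def[symmetric] \<beta>_def[symmetric] \<Phi>_def[symmetric]
        by (intro mult_nonneg_nonpos) auto
      finally show ?thesis .
    qed
    ultimately show "\<exists>y. (P has_real_derivative y) (at x) \<and> y \<le> 0" by blast
  qed
  moreover have "P 0 = 0" by (simp add: P_def \<Phi>_def)
  \<comment> \<open>The powers and the terms carrying a factor \<open>u\<close> or \<open>v\<close>
    vanish at \<open>R\<close>; what remains is \<open>\<Phi> R * a R * b R\<close>.\<close>
  moreover have "P R > 0"
  proof -
    have "a R > 0" "b R > 0"
      using solution_slope_pos[OF s qp] solution_slope_pos[OF s[unfolded solution_swap[of q]]] data R qp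
      by (auto simp: a_def b_def h_def[abs_def] k_def[abs_def])
    moreover have "\<Phi> R > 0"
      using slope_pos[of "\<lambda>_. 1" R] R w_pos[of R] by (auto simp: \<Phi>_def slope_def zero_less_divide_iff)
    ultimately show ?thesis using qp zero by (simp add: P_def pos_power_def)
  qed
  ultimately show False by simp
qed

section \<open>Which component vanishes first for extreme data\<close>

lemma potential_1_pos:
  assumes "r > 0"
  shows "potential (\<lambda>_. 1) r > 0"
proof -
  have "- potential (\<lambda>_. 1) r < - potential (\<lambda>_. 1) 0"
  proof (rule strictly_decreasing_from_derivative_halfline[of "\<lambda>r. - potential (\<lambda>_. 1) r"])
    show "((\<lambda>r. - potential (\<lambda>_. 1) r) has_real_derivative - slope (\<lambda>_. 1) s) (at s within {0..})"
      if "s \<ge> 0" for s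
      using that by (intro DERIV_minus potential_has_derivative) auto
    show "- slope (\<lambda>_. 1) s < 0" if "s > 0" for s
      using that slope_pos[of "\<lambda>_. 1" s] by simp
  qed (use assms in auto)
  then show ?thesis by simp
qed

text \<open>A small \<open>v\<close> hardly lowers \<open>u\<close>, which stays above
  \<open>\<xi> / 2\<close> on \<open>{0..1}\<close>; this source is then strong enough to push the
  small datum \<open>\<eta>\<close> below zero by radius \<open>1\<close>.\<close>

lemma small_data_crosses:
  assumes qp: "q > 0" "p > 0" and "\<xi> > 0"
  obtains \<eta>0 where "\<eta>0 > 0"
    "\<And>\<eta> u v. 0 < \<eta> \<Longrightarrow> \<eta> \<le> \<eta>0 \<Longrightarrow> solution q p \<xi> \<eta> u v \<Longrightarrow> u 1 > 0 \<and> v 1 < 0"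
proof -
  define c where "c = potential (\<lambda>_. 1) 1"
  have "c > 0" by (simp add: c_def potential_1_pos)
  \<comment> \<open>The first entry ensures that \<open>u\<close> loses at most
    \<open>\<xi> / 2\<close>. The second, halved for strictness, lies below the amount that
    \<open>v\<close> loses.\<close>
  define \<eta>0 where "\<eta>0 = min ((\<xi> / (2 * c)) powr (1 / q)) (c * pos_power p (\<xi> / 2) / 2)"
  show ?thesis
  proof
    show "\<eta>0 > 0" using \<open>c > 0\<close> assms by (auto simp: \<eta>0_def pos_power_pos)
    fix \<eta> u v assume \<eta>: "0 < \<eta>" "\<eta> \<le> \<eta>0" and s: "solution q p \<xi> \<eta> u v"
    note SD = solutionD[OF s]
    note [continuous_intros] = SD(1,2)
    have "\<eta> powr q \<le> ((\<xi> / (2 * c)) powr (1 / q)) powr q"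
      using \<eta> qp by (intro powr_mono2) (auto simp: \<eta>0_def)
    also have "\<dots> = \<xi> / (2 * c)" using qp assms \<open>c > 0\<close> by (simp add: powr_powr)
    finally have "pos_power q \<eta> * c \<le> \<xi> / 2"
      using \<open>c > 0\<close> \<eta> by (simp add: pos_power_def field_simps)
    moreover have "potential (\<lambda>s. pos_power q (v s)) 1 \<le> potential (\<lambda>s. pos_power q \<eta>) 1"
      by (intro potential_mono continuous_intros qp pos_power_mono solution_le[OF s]) auto
    ultimately have u1: "u 1 \<ge> \<xi> / 2"
      using SD(5)[of 1] by (simp add: potential_const[of "pos_power q \<eta>"] c_def)
    have "u t \<ge> \<xi> / 2" if "t \<in> {0..1}" for t
      using solution_decreasing(1)[OF s qp \<open>\<xi> > 0\<close> \<open>0 < \<eta>\<close>, of t 1] that u1 by (cases "t = 1") auto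
    then have "potential (\<lambda>s. pos_power p (\<xi> / 2)) 1 \<le> potential (\<lambda>s. pos_power p (u s)) 1"
      by (intro potential_mono continuous_intros qp pos_power_mono) auto
    moreover have "\<eta> < c * pos_power p (\<xi> / 2)"
      using \<eta> \<open>c > 0\<close> assms pos_power_pos[of "\<xi> / 2" p] by (auto simp: \<eta>0_def)
    ultimately have "v 1 < 0"
      using SD(6)[of 1] by (simp add: potential_const[of "pos_power p (\<xi> / 2)"] c_def mult.commute)
    then show "u 1 > 0 \<and> v 1 < 0" using u1 assms by auto
  qed
qed

text \<open>For large \<open>\<eta>\<close> the loss of \<open>v\<close> up to radius
  \<open>1\<close> is at most half of \<open>\<eta>\<close>, and a source of size
  \<open>(\<eta> / 2) powr q\<close> makes \<open>u\<close> negative.\<close>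

lemma large_data_crosses:
  assumes qp: "q > 0" "p > 0" and "\<xi> > 0"
  obtains \<eta>1 where "\<eta>1 > 0"
    "\<And>\<eta> u v. \<eta>1 \<le> \<eta> \<Longrightarrow> solution q p \<xi> \<eta> u v \<Longrightarrow> u 1 < 0 \<and> v 1 > 0"
proof -
  define c where "c = potential (\<lambda>_. 1) 1"
  have "c > 0" by (simp add: c_def potential_1_pos)
  \<comment> \<open>With \<open>\<eta> \<ge> \<eta>1\<close>, the first entry keeps
    \<open>v \<ge> \<eta> / 2\<close> on \<open>{0..1}\<close>; the second makes the loss of
    \<open>u\<close> at least \<open>2 * \<xi>\<close>, so \<open>u 1 \<le> - \<xi>\<close>.\<close>
  define \<eta>1 where "\<eta>1 = 2 * max (pos_power p \<xi> * c) ((2 * \<xi> / c) powr (1 / q))"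
  show ?thesis
  proof
    show "\<eta>1 > 0" using \<open>c > 0\<close> assms by (auto simp: \<eta>1_def less_max_iff_disj)
    fix \<eta> u v assume \<eta>: "\<eta>1 \<le> \<eta>" and s: "solution q p \<xi> \<eta> u v"
    note SD = solutionD[OF s]
    note [continuous_intros] = SD(1,2)
    have "\<eta> > 0" using \<eta> \<open>\<eta>1 > 0\<close> by simp
    have "potential (\<lambda>s. pos_power p (u s)) 1 \<le> potential (\<lambda>s. pos_power p \<xi>) 1"
      by (intro potential_mono continuous_intros qp pos_power_mono solution_le[OF s]) auto
    moreover have "pos_power p \<xi> * c \<le> \<eta> / 2" using \<eta> by (auto simp: \<eta>1_def)
    ultimately have v1: "v 1 \<ge> \<eta> / 2"
      using SD(6)[of 1] by (simp add: potential_const[of "pos_power p \<xi>"] c_def)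
    have "v t \<ge> \<eta> / 2" if "t \<in> {0..1}" for t
      using solution_decreasing(2)[OF s qp \<open>\<xi> > 0\<close> \<open>0 < \<eta>\<close>, of t 1] that v1 by (cases "t = 1") auto
    then have *: "potential (\<lambda>s. pos_power q (\<eta> / 2)) 1 \<le> potential (\<lambda>s. pos_power q (v s)) 1"
      by (intro potential_mono continuous_intros qp pos_power_mono) auto
    have "2 * \<xi> / c = ((2 * \<xi> / c) powr (1 / q)) powr q"
      using qp assms \<open>c > 0\<close> by (simp add: powr_powr)
    also have "\<dots> \<le> (\<eta> / 2) powr q"
      using \<eta> qp by (intro powr_mono2) (auto simp: \<eta>1_def)
    finally have "2 * \<xi> \<le> pos_power q (\<eta> / 2) * c"
      using \<open>c > 0\<close> \<open>\<eta> > 0\<close> by (simp add: pos_power_def field_simps)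
    then have "u 1 < 0"
      using SD(5)[of 1] * assms by (simp add: potential_const[of "pos_power q (\<eta> / 2)"] c_def)
    then show "u 1 < 0 \<and> v 1 > 0" using v1 \<open>\<eta> > 0\<close> by auto
  qed
qed

end

subsection \<open>Shooting\<close>

context radial_weight
begin

text \<open>Uniqueness is available only while all components are positive, so two solutions with
  the same data are compared up to the first zero \<open>m\<close> of any component. They still
  agree at \<open>m\<close>; by monotonicity, the first kind of crossing forces
  \<open>v1 m > 0\<close> and the second \<open>u2 m > 0\<close>, so nothing vanishes at
  \<open>m\<close>.\<close>

lemma crossing_types_exclusive:
  assumes s1: "solution q p \<xi> \<eta> u1 v1" and s2: "solution q p \<xi> \<eta> u2 v2"
    and qp: "q > 0" "p > 0" and data: "\<xi> > 0" "\<eta> > 0"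
    and a: "a \<ge> 0" "u1 a < 0" "v1 a > 0" and b: "b \<ge> 0" "u2 b > 0" "v2 b < 0"
  shows False
proof -
  note D1 = solutionD[OF s1] and D2 = solutionD[OF s2]
  note [continuous_intros] = D1(1,2) D2(1,2)
  define f where "f r = min (min (u1 r) (v1 r)) (min (u2 r) (v2 r))" for r
  have "continuous_on {0..} f" unfolding f_def by (intro continuous_intros)
  moreover have "f 0 > 0" "f a \<le> 0" using D1 D2 data a by (auto simp: f_def)
  ultimately obtain m where m: "0 < m" "f m = 0" "\<And>t. 0 \<le> t \<Longrightarrow> t < m \<Longrightarrow> f t > 0"
    using first_zero a(1) by metis
  define g where "g r = \<bar>u1 r - u2 r\<bar> + \<bar>v1 r - v2 r\<bar>" for r
  have cg: "continuous_on {0..} g" unfolding g_def by (intro continuous_intros)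
  \<comment> \<open>Uniqueness gives agreement on \<open>{0..<m}\<close>; continuity carries it to
    \<open>m\<close> itself.\<close>
  have closure: "closure {0..<m} = {0..m}" using m(1) by simp
  have "g t = 0" if "t \<in> {0..<m}" for t
    using solution_unique_while_positive[OF s1 s2 qp data, of t t] m(3)[of t] that
    by (auto simp: f_def g_def)
  moreover have "continuous_on (closure {0..<m}) g"
    unfolding closure by (rule continuous_on_subset[OF cg]) auto
  moreover have "m \<in> closure {0..<m}" unfolding closure using m(1) by simp
  ultimately have "g m = 0" by (metis continuous_constant_on_closure)
  then have eq: "u1 m = u2 m" "v1 m = v2 m" by (auto simp: g_def)
  have "u2 b \<le> u2 m" if "m \<le> b"
    using solution_decreasing(1)[OF s2 qp data, of m b] that m by (cases "m = b") auto
  then have "u2 m \<noteq> 0" using m(3)[of b] b by (force simp: f_def)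
  have "v1 a \<le> v1 m" if "m \<le> a"
    using solution_decreasing(2)[OF s1 qp data, of m a] that m by (cases "m = a") auto
  then have "v1 m \<noteq> 0" using m(3)[of a] a by (force simp: f_def)
  then show False using \<open>u2 m \<noteq> 0\<close> eq m(2) by (auto simp: f_def min_def split: if_splits)
qed

text \<open>Strict decrease makes \<open>u\<close> negative right after its zero, while
  \<open>v\<close> is still positive by continuity. Strict signs, unlike a zero, are stable under
  perturbation of the solution.\<close>

lemma crosses_after_zero:
  assumes s: "solution q p \<xi> \<eta> u v" and qp: "q > 0" "p > 0" and data: "\<xi> > 0" "\<eta> > 0"
    and m: "m \<ge> 0" "u m = 0" "v m > 0"
  shows "\<exists>a\<ge>0. u a < 0 \<and> v a > 0"
proof -
  have "\<forall>\<^sub>F s in at m within {0..}. v s > 0"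
    using solutionD(2)[OF s] m by (auto simp: continuous_on_def intro: order_tendstoD(1))
  then obtain d where d: "d > 0" "\<And>s. m < s \<Longrightarrow> s < m + d \<Longrightarrow> v s > 0"
    using m(1) unfolding eventually_at by (auto simp: dist_real_def)
  have "u (m + d / 2) < 0"
    using solution_decreasing(1)[OF s qp data m(1), of "m + d / 2"] d m by auto
  then show ?thesis using d m by (intro exI[of _ "m + d / 2"]) auto
qed

text \<open>At the first zero of \<open>min (u r) (v r)\<close> the Pohozaev argument forbids both
  components to vanish, so exactly one of them crosses.\<close>

lemma solution_trichotomy:
  assumes s: "solution q p \<xi> \<eta> u v" and qp: "q > 0" "p > 0" and data: "\<xi> > 0" "\<eta> > 0"
    and crit: "\<And>r. r > 0 \<Longrightarrow> (1 + 1 / (p + 1) + 1 / (q + 1)) * (w r)\<^sup>2 \<le> 2 * flux (\<lambda>_. 1) r * w' r"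
  obtains "\<And>r. r \<ge> 0 \<Longrightarrow> u r > 0 \<and> v r > 0"
    | a where "a \<ge> 0" "u a < 0" "v a > 0"
    | b where "b \<ge> 0" "u b > 0" "v b < 0"
proof (cases "\<forall>r\<ge>0. u r > 0 \<and> v r > 0")
  case False
  define f where "f r = min (u r) (v r)" for r
  obtain b where b: "b \<ge> 0" "f b \<le> 0" using False by (force simp: f_def)
  have "continuous_on {0..} f" unfolding f_def using solutionD[OF s] by (intro continuous_intros)
  moreover have "f 0 > 0" using solutionD[OF s] data by (auto simp: f_def)
  ultimately obtain m where m: "0 < m" "f m = 0" using first_zero b by metis
  moreover have "\<not> (u m = 0 \<and> v m = 0)" using pohozaev[OF s qp data crit] m(1) by blast
  ultimately consider "u m = 0" "v m > 0" | "v m = 0" "u m > 0"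
    by (auto simp: f_def min_def split: if_splits)
  then show ?thesis
  proof cases
    case 1
    then show ?thesis using crosses_after_zero[OF s qp data, of m] m that(2) by auto
  next
    case 2
    then show ?thesis
      using crosses_after_zero[OF s[unfolded solution_swap[of q]] qp(2,1) data(2,1), of m] m that(3)
      by auto
  qed
qed (use that in blast)

text \<open>By comparison, \<open>V k\<close> increases and \<open>U k\<close> decreases with the
  datum \<open>e k\<close>; monotone data therefore give pointwise monotone sequences of
  solutions.\<close>

lemma monotone_data_limit:
  assumes qp: "q > 0" "p > 0" and e: "e \<longlonglongrightarrow> \<eta>"
    and mono: "(\<forall>k. e k < e (Suc k)) \<or> (\<forall>k. e (Suc k) < e k)"
    and sol: "\<And>k. solution q p \<xi> (e k) (U k) (V k)"
  obtains u v where "solution q p \<xi> \<eta> u v"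
    "\<And>r. r \<ge> 0 \<Longrightarrow> (\<lambda>k. U k r) \<longlonglongrightarrow> u r" "\<And>r. r \<ge> 0 \<Longrightarrow> (\<lambda>k. V k r) \<longlonglongrightarrow> v r"
proof -
  obtain C where "\<And>k. \<bar>e k\<bar> \<le> C"
    using convergent_imp_Bseq[of e] e by (auto simp: Bseq_def convergent_def)
  then have bound: "U k r \<le> max \<xi> C" "V k r \<le> max \<xi> C" if "r \<ge> 0" for k r
    using solution_le[OF sol qp that, of k] by (auto simp: le_max_iff_disj abs_le_iff intro: order_trans)
  have *: "V k r \<le> V j r" "U j r \<le> U k r" if "e k < e j" "r \<ge> 0" for j k r
    using solution_compare[OF sol[of k] sol[of j] qp order_refl that] that by auto
  have monoseq: "monoseq (\<lambda>k. U k r)" "monoseq (\<lambda>k. V k r)" if "r \<ge> 0" for r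
    using mono *[OF _ that] unfolding monoseq_Suc by blast+
  show ?thesis
    by (rule monotone_limit[of q p U V 0 "\<lambda>_. \<xi>" e \<xi> \<eta> "max \<xi> C"])
      (use qp e sol bound monoseq that in \<open>simp_all add: solution_def\<close>)
qed

theorem global_solution_exists:
  assumes qp: "q > 0" "p > 0" and \<xi>: "\<xi> > 0"
    and crit: "\<And>r. r > 0 \<Longrightarrow> (1 + 1 / (p + 1) + 1 / (q + 1)) * (w r)\<^sup>2 \<le> 2 * flux (\<lambda>_. 1) r * w' r"
  shows "\<exists>\<eta>>0. \<exists>u v. solution q p \<xi> \<eta> u v \<and> (\<forall>r\<ge>0. u r > 0 \<and> v r > 0)"
proof (rule ccontr)
  define A where "A u v \<longleftrightarrow> (\<exists>a\<ge>0. u a < 0 \<and> v a > 0)" for u v :: "real \<Rightarrow> real"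
  define B where "B u v \<longleftrightarrow> (\<exists>b\<ge>0. u b > 0 \<and> v b < 0)" for u v :: "real \<Rightarrow> real"
  assume "\<not> ?thesis"
  then have AB: "A u v \<or> B u v" if "solution q p \<xi> \<eta> u v" "\<eta> > 0" for \<eta> u v
    using that solution_trichotomy[OF that(1) qp \<xi> that(2) crit] unfolding A_def B_def by metis
  have excl: "\<not> (A u1 v1 \<and> B u2 v2)"
    if "solution q p \<xi> \<eta> u1 v1" "solution q p \<xi> \<eta> u2 v2" "\<eta> > 0" for \<eta> u1 v1 u2 v2
    using crossing_types_exclusive[OF that(1,2) qp \<xi> that(3)] by (auto simp: A_def B_def)
  \<comment> \<open>\<open>S\<close> collects the data for which \<open>v\<close> crosses first.
    Comparison makes this kind of crossing pass to smaller data.\<close>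
  define S where "S = {\<eta>. \<eta> > 0 \<and> (\<exists>u v. solution q p \<xi> \<eta> u v \<and> B u v)}"
  obtain \<eta>0 where \<eta>0: "\<eta>0 > 0"
    "\<And>\<eta> u v. 0 < \<eta> \<Longrightarrow> \<eta> \<le> \<eta>0 \<Longrightarrow> solution q p \<xi> \<eta> u v \<Longrightarrow> u 1 > 0 \<and> v 1 < 0"
    using small_data_crosses[OF qp \<xi>] by metis
  obtain \<eta>1 where \<eta>1: "\<eta>1 > 0"
    "\<And>\<eta> u v. \<eta>1 \<le> \<eta> \<Longrightarrow> solution q p \<xi> \<eta> u v \<Longrightarrow> u 1 < 0 \<and> v 1 > 0"
    using large_data_crosses[OF qp \<xi>] by metis
  obtain u0 v0 where "solution q p \<xi> \<eta>0 u0 v0" using solution_exists[OF qp] by metis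
  then have \<eta>0_S: "\<eta>0 \<in> S"
    using \<eta>0 by (force simp: S_def B_def intro: exI[of _ 1])
  have "\<eta> \<le> \<eta>1" if \<eta>_S: "\<eta> \<in> S" for \<eta>
  proof (rule ccontr)
    assume "\<not> \<eta> \<le> \<eta>1"
    obtain u v where s: "solution q p \<xi> \<eta> u v" "B u v" "\<eta> > 0" using \<eta>_S by (auto simp: S_def)
    moreover have "A u v"
      using \<eta>1(2)[OF _ s(1)] \<open>\<not> \<eta> \<le> \<eta>1\<close> unfolding A_def by (intro exI[of _ 1]) auto
    ultimately show False using excl by blast
  qed
  then have bdd: "bdd_above S" by (auto simp: bdd_above_def)
  define \<eta>s where "\<eta>s = Sup S"
  have "\<eta>s > 0" using cSup_upper[OF \<eta>0_S bdd] \<eta>0(1) by (simp add: \<eta>s_def)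
  have below: "B u v" if \<eta>: "0 < \<eta>" "\<eta> < \<eta>s" "solution q p \<xi> \<eta> u v" for \<eta> u v
  proof -
    obtain \<eta>' where "\<eta>' \<in> S" "\<eta> < \<eta>'"
      using \<eta>(2) less_cSup_iff[of S \<eta>] \<eta>0_S bdd by (auto simp: \<eta>s_def)
    then obtain u' v' where s': "solution q p \<xi> \<eta>' u' v'" "B u' v'" by (auto simp: S_def)
    then obtain b where b: "b \<ge> 0" "u' b > 0" "v' b < 0" by (auto simp: B_def)
    have "v b < 0" "u b > 0"
      using solution_compare[OF \<eta>(3) s'(1) qp order_refl \<open>\<eta> < \<eta>'\<close> b(1)] b \<open>\<eta> < \<eta>'\<close> by auto
    then show ?thesis using b by (auto simp: B_def)
  qed
  have above: "A u v" if "\<eta>s < \<eta>" "solution q p \<xi> \<eta> u v" for \<eta> u v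
  proof -
    have "\<eta> > 0" using that \<open>\<eta>s > 0\<close> by simp
    moreover have "\<eta> \<notin> S" using cSup_upper[of \<eta> S] bdd that by (auto simp: \<eta>s_def)
    ultimately show ?thesis using AB[OF that(2)] that(2) by (auto simp: S_def)
  qed
  obtain u v where s: "solution q p \<xi> \<eta>s u v" "B u v"
  proof -
    \<comment> \<open>The factor \<open>1 / 2\<close> keeps \<open>e 0\<close> positive, so the
      whole increasing sequence lies in the range covered by \<open>below\<close>.\<close>
    define e where "e k = \<eta>s - \<eta>s / 2 * inverse (real (Suc k))" for k
    have e: "0 < e k" "e k < \<eta>s" "e k < e (Suc k)" for k
      using \<open>\<eta>s > 0\<close> by (auto simp: e_def field_simps intro!: add_pos_nonneg)
    have "e \<longlonglongrightarrow> \<eta>s - \<eta>s / 2 * 0"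
      unfolding e_def by (intro tendsto_intros LIMSEQ_inverse_real_of_nat)
    then have lim: "e \<longlonglongrightarrow> \<eta>s" by simp
    have "\<exists>U V. solution q p \<xi> (e k) U V" for k using solution_exists[OF qp] by metis
    then obtain U V where UV: "\<And>k. solution q p \<xi> (e k) (U k) (V k)" by metis
    obtain u v where s: "solution q p \<xi> \<eta>s u v"
      and U: "\<And>r. r \<ge> 0 \<Longrightarrow> (\<lambda>k. U k r) \<longlonglongrightarrow> u r"
      and V: "\<And>r. r \<ge> 0 \<Longrightarrow> (\<lambda>k. V k r) \<longlonglongrightarrow> v r"
      using monotone_data_limit[OF qp lim _ UV] e(3) by metis
    \<comment> \<open>\<open>A\<close> at a point \<open>a\<close> is an open condition: it would
      pass to \<open>U k\<close>, \<open>V k\<close> for large \<open>k\<close>, which satisfy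
      \<open>B\<close>.\<close>
    have "\<not> A u v"
    proof
      assume "A u v"
      then obtain a where a: "a \<ge> 0" "u a < 0" "v a > 0" by (auto simp: A_def)
      have "\<forall>\<^sub>F k in sequentially. U k a < 0 \<and> V k a > 0"
        using order_tendstoD(2)[OF U[OF a(1)] a(2)] order_tendstoD(1)[OF V[OF a(1)] a(3)]
        by eventually_elim auto
      then obtain k where "U k a < 0 \<and> V k a > 0"
        using eventually_happens'[OF sequentially_bot] by blast
      then show False
        using excl[OF UV[of k] UV[of k] e(1)] below[OF e(1,2) UV[of k]] a by (auto simp: A_def)
    qed
    then show ?thesis using that AB s \<open>\<eta>s > 0\<close> by blast
  qed
  \<comment> \<open>Approach from above: here the approximating solutions satisfy \<open>A\<close>,
    and the limit inherits it.\<close>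
  obtain u' v' where s': "solution q p \<xi> \<eta>s u' v'" "A u' v'"
  proof -
    define e where "e k = \<eta>s + inverse (real (Suc k))" for k
    have e: "\<eta>s < e k" "e (Suc k) < e k" for k by (auto simp: e_def field_simps)
    then have e0: "0 < e k" for k using \<open>\<eta>s > 0\<close> less_trans by blast
    have lim: "e \<longlonglongrightarrow> \<eta>s" unfolding e_def by (rule LIMSEQ_inverse_real_of_nat_add)
    have "\<exists>U V. solution q p \<xi> (e k) U V" for k using solution_exists[OF qp] by metis
    then obtain U V where UV: "\<And>k. solution q p \<xi> (e k) (U k) (V k)" by metis
    obtain u v where s: "solution q p \<xi> \<eta>s u v"
      and U: "\<And>r. r \<ge> 0 \<Longrightarrow> (\<lambda>k. U k r) \<longlonglongrightarrow> u r"
      and V: "\<And>r. r \<ge> 0 \<Longrightarrow> (\<lambda>k. V k r) \<longlonglongrightarrow> v r"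
      using monotone_data_limit[OF qp lim _ UV] e(2) by metis
    have "\<not> B u v"
    proof
      assume "B u v"
      then obtain b where b: "b \<ge> 0" "u b > 0" "v b < 0" by (auto simp: B_def)
      have "\<forall>\<^sub>F k in sequentially. U k b > 0 \<and> V k b < 0"
        using order_tendstoD(1)[OF U[OF b(1)] b(2)] order_tendstoD(2)[OF V[OF b(1)] b(3)]
        by eventually_elim auto
      then obtain k where "U k b > 0 \<and> V k b < 0"
        using eventually_happens'[OF sequentially_bot] by blast
      then show False
        using excl[OF UV[of k] UV[of k] e0] above[OF e(1) UV[of k]] b by (auto simp: B_def)
    qed
    then show ?thesis using that AB s \<open>\<eta>s > 0\<close> by blast
  qed
  show False using excl[OF s'(1) s(1) \<open>\<eta>s > 0\<close>] s s' by blast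
qed

section \<open>Decay at infinity and order between the initial data\<close>

text \<open>If \<open>u\<close> stayed above some \<open>\<epsilon> > 0\<close>, then
  \<open>v\<close> would lie below \<open>\<eta>\<close> minus a positive multiple of the unbounded
  function \<open>potential (\<lambda>_. 1)\<close> and become negative. Since \<open>u\<close>
  decreases, it tends to \<open>0\<close>.\<close>

lemma global_solution_tendsto_0:
  assumes s: "solution q p \<xi> \<eta> u v" and qp: "q > 0" "p > 0"
    and pos: "\<And>r. r \<ge> 0 \<Longrightarrow> u r > 0 \<and> v r > 0"
    and unbounded: "\<And>C. \<exists>r\<ge>0. potential (\<lambda>_. 1) r > C"
  shows "(u \<longlongrightarrow> 0) at_top"
proof -
  note SD = solutionD[OF s]
  note [continuous_intros] = SD(1,2)
  have data: "\<xi> > 0" "\<eta> > 0" using pos[of 0] SD by auto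
  have dec: "u t \<le> u r" if "0 \<le> r" "r \<le> t" for r t
    using solution_decreasing(1)[OF s qp data, of r t] that by (cases "r = t") auto
  have small: "\<exists>r\<ge>0. u r < \<epsilon>" if "\<epsilon> > 0" for \<epsilon>
  proof (rule ccontr)
    assume "\<not> ?thesis"
    then have ge: "u r \<ge> \<epsilon>" if "r \<ge> 0" for r using that by force
    have c: "pos_power p \<epsilon> > 0" using that by (rule pos_power_pos)
    obtain r where r: "r \<ge> 0" "potential (\<lambda>_. 1) r > \<eta> / pos_power p \<epsilon>" using unbounded by blast
    have "potential (\<lambda>_. pos_power p \<epsilon>) r \<le> potential (\<lambda>s. pos_power p (u s)) r"
      using ge by (intro potential_mono continuous_intros qp pos_power_mono) auto
    then have "v r \<le> \<eta> - pos_power p \<epsilon> * potential (\<lambda>_. 1) r"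
      using SD(6)[OF r(1)] by (simp add: potential_const[of "pos_power p \<epsilon>"])
    also have "\<dots> < 0" using r c by (simp add: field_simps)
    finally show False using pos[OF r(1)] by simp
  qed
  show ?thesis
  proof (rule order_tendstoI)
    show "\<forall>\<^sub>F x in at_top. y < u x" if "y < 0" for y
      using eventually_ge_at_top[of "0::real"] by eventually_elim (use that pos in force)
    fix \<epsilon> :: real assume "\<epsilon> > 0"
    then obtain r where r: "r \<ge> 0" "u r < \<epsilon>" using small by blast
    show "\<forall>\<^sub>F x in at_top. u x < \<epsilon>"
      using eventually_ge_at_top[of r] by eventually_elim (use dec[OF r(1)] r in force)
  qed
qed

text \<open>If \<open>\<eta>1 < \<eta>2\<close>, comparison keeps \<open>v2\<close> above
  \<open>v1 + (\<eta>2 - \<eta>1)\<close>, hence away from \<open>0\<close>, against the decay of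
  \<open>v2\<close>. Applied in both directions with equal \<open>\<xi>\<close>, this gives
  uniqueness of \<open>\<eta>\<close>.\<close>

lemma global_solution_data_mono:
  assumes s1: "solution q p \<xi>1 \<eta>1 u1 v1" and s2: "solution q p \<xi>2 \<eta>2 u2 v2"
    and qp: "q > 0" "p > 0"
    and pos1: "\<And>r. r \<ge> 0 \<Longrightarrow> u1 r > 0 \<and> v1 r > 0"
    and pos2: "\<And>r. r \<ge> 0 \<Longrightarrow> u2 r > 0 \<and> v2 r > 0"
    and unbounded: "\<And>C. \<exists>r\<ge>0. potential (\<lambda>_. 1) r > C"
    and le: "\<xi>2 \<le> \<xi>1"
  shows "\<eta>2 \<le> \<eta>1"
proof (rule ccontr)
  assume "\<not> \<eta>2 \<le> \<eta>1"
  then have less: "\<eta>1 < \<eta>2" by simp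
  have "(v2 \<longlongrightarrow> 0) at_top"
    using global_solution_tendsto_0[OF s2[unfolded solution_swap[of q]] qp(2,1) _ unbounded] pos2 by blast
  then have "\<forall>\<^sub>F r in at_top. v2 r < \<eta>2 - \<eta>1"
    using less by (intro order_tendstoD(2)) auto
  then have "\<forall>\<^sub>F r in at_top. v2 r < \<eta>2 - \<eta>1 \<and> r \<ge> 0"
    using eventually_ge_at_top by (rule eventually_conj)
  then obtain r where "v2 r < \<eta>2 - \<eta>1" "r \<ge> 0"
    using eventually_happens'[OF trivial_limit_at_top_linorder] by blast
  then show False
    using solution_compare(1)[OF s1 s2 qp le less, of r] pos1[of r] by auto
qed

end

subsection \<open>Cartan-Hadamard models\<close>

lemma C1_halfline_continuous:
  assumes "C1_halfline f"
  shows "continuous_on {0..} f"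
proof -
  obtain f' where "\<And>r. r \<ge> 0 \<Longrightarrow> (f has_real_derivative f' r) (at r within {0..})"
    using assms by (auto simp: C1_halfline_def)
  then show ?thesis by (auto intro!: DERIV_continuous_on)
qed

section \<open>Passage between differential and integral form, and integrability of the
  slope\<close>

context radial_weight
begin

text \<open>The quantity \<open>w u' + flux h\<close> is constant, and it vanishes at the pole
  because \<open>w 0 = 0\<close> and \<open>u'\<close> is continuous up to \<open>0\<close>.
  Dividing by \<open>w\<close> and integrating once more gives the claim.\<close>

lemma integrate_radial_equation:
  assumes u: "C1_halfline u" and h: "continuous_on {0..} h"
    and eq: "\<And>r. r > 0 \<Longrightarrow> ((\<lambda>s. w s * deriv u s) has_real_derivative - (w r * h r)) (at r)"
    and r: "r \<ge> 0"
  shows "u r = u 0 - potential h r"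
proof (cases "r = 0")
  case False
  then have "r > 0" using r by simp
  obtain u' where u': "\<And>r. r \<ge> 0 \<Longrightarrow> (u has_real_derivative u' r) (at r within {0..})"
    "continuous_on {0..} u'"
    using u by (auto simp: C1_halfline_def)
  have deriv_u: "deriv u s = u' s" and du: "(u has_real_derivative u' s) (at s)" if "s > 0" for s
    using u'(1)[of s] that by (auto simp: at_within_halfline intro: DERIV_imp_deriv)
  have flux_d: "(flux h has_real_derivative w s * h s) (at s)" if "s > 0" for s
    using flux_has_derivative[OF h, of s] that by (auto simp: at_within_halfline)
  have cf: "continuous_on {0..} (flux h)"
    using flux_has_derivative[OF h] by (auto intro!: DERIV_continuous_on)
  have slope_eq: "u' s = - slope h s" if "s > 0" for s
  proof -
    have "w s * u' s + flux h s = w 0 * u' 0 + flux h 0"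
    proof (rule DERIV_isconst_end[OF that, of "\<lambda>s. w s * u' s + flux h s"])
      show "continuous_on {0..s} (\<lambda>s. w s * u' s + flux h s)"
        by (rule continuous_on_subset[of "{0..}"])
          (auto intro!: continuous_intros w_cont u'(2) cf)
      fix x assume x: "0 < x" "x < s"
      have "((\<lambda>s. w s * u' s) has_real_derivative - (w x * h x)) (at x)"
        by (rule has_field_derivative_transform_within_open[OF eq[OF x(1)], of "{0<..}"])
          (use x deriv_u in auto)
      then show "((\<lambda>s. w s * u' s + flux h s) has_real_derivative 0) (at x)"
        using DERIV_add[OF _ flux_d[OF x(1)]] by fastforce
    qed
    then show ?thesis using w_pos[OF that] by (simp add: w_0 slope_def field_simps)
  qed
  have cu: "continuous_on {0..} u" using u by (rule C1_halfline_continuous)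
  have "u r + potential h r = u 0 + potential h 0"
  proof (rule DERIV_isconst_end[OF \<open>r > 0\<close>, of "\<lambda>s. u s + potential h s"])
    show "continuous_on {0..r} (\<lambda>s. u s + potential h s)"
      by (rule continuous_on_subset[of "{0..}"])
        (auto intro!: continuous_intros cu potential_continuous h)
    fix x assume x: "0 < x" "x < r"
    have "(potential h has_real_derivative slope h x) (at x)"
      using potential_has_derivative[OF h, of x] x by (auto simp: at_within_halfline)
    then show "((\<lambda>s. u s + potential h s) has_real_derivative 0) (at x)"
      using du[OF x(1)] slope_eq[OF x(1)] by (auto intro!: derivative_eq_intros)
  qed
  then show ?thesis by simp
qed auto

text \<open>Here \<open>u' = - slope h\<close>, so \<open>w u' = - flux h\<close>, and the quotient
  rule yields \<open>u''\<close> in terms of \<open>h\<close>, \<open>w'\<close> and the slope, all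
  continuous away from the pole.\<close>

lemma radial_equation_of_potential:
  assumes h: "continuous_on {0..} h" and u: "\<And>r. r \<ge> 0 \<Longrightarrow> u r = c - potential h r"
  shows "C1_halfline u" "Ck_on 2 u {0<..}" "(u has_real_derivative 0) (at 0 within {0..})"
    "r > 0 \<Longrightarrow> ((\<lambda>s. w s * deriv u s) has_real_derivative - (w r * h r)) (at r)"
proof -
  have du: "(u has_real_derivative - slope h r) (at r within {0..})" if "r \<ge> 0" for r
  proof -
    have "((\<lambda>r. c - potential h r) has_real_derivative - slope h r) (at r within {0..})"
      using potential_has_derivative[OF h that] by (auto intro!: derivative_eq_intros)
    then show ?thesis
      by (rule has_field_derivative_transform_within[OF _ zero_less_one]) (use u that in auto)
  qed
  then show "C1_halfline u"
    unfolding C1_halfline_def using slope_continuous[OF h]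
    by (intro exI[of _ "\<lambda>r. - slope h r"]) (auto intro!: continuous_intros)
  show "(u has_real_derivative 0) (at 0 within {0..})" using du[of 0] by simp
  have du': "(u has_real_derivative - slope h r) (at r)" if "r > 0" for r
    using du[of r] that by (auto simp: at_within_halfline)
  then have deriv_u: "deriv u r = - slope h r" if "r > 0" for r
    using that by (auto intro: DERIV_imp_deriv)
  define s' where "s' r = - (h r - w' r * slope h r / w r)" for r
  have ddu: "(deriv u has_real_derivative s' r) (at r)" if "r > 0" for r
  proof -
    have "((\<lambda>r. - slope h r) has_real_derivative s' r) (at r)"
      unfolding s'_def by (intro DERIV_minus slope_has_derivative h that)
    then show ?thesis
      by (rule has_field_derivative_transform_within_open[of _ _ _ "{0<..}"]) (use that deriv_u in auto)
  qed
  then have deriv2_u: "deriv (deriv u) r = s' r" if "r > 0" for r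
    using that by (auto intro: DERIV_imp_deriv)
  have "continuous_on {0<..} s'"
    unfolding s'_def
    by (intro continuous_intros w'_cont continuous_on_subset[OF h]
        continuous_on_subset[OF slope_continuous[OF h]] continuous_on_subset[OF w_cont])
      (auto simp: less_imp_neq[OF w_pos, symmetric])
  then have "continuous_on {0<..} (deriv (deriv u))"
    by (rule continuous_on_eq) (use deriv2_u in auto)
  then show "Ck_on 2 u {0<..}"
    using du' ddu unfolding Ck_on_def
    by (auto simp: less_Suc_eq numeral_2_eq_2 real_differentiable_def)
  show "((\<lambda>s. w s * deriv u s) has_real_derivative - (w r * h r)) (at r)" if r: "r > 0"
  proof -
    have "((\<lambda>s. - flux h s) has_real_derivative - (w r * h r)) (at r)"
      using flux_has_derivative[OF h, of r] r by (auto simp: at_within_halfline intro!: DERIV_minus)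
    then show ?thesis
      by (rule has_field_derivative_transform_within_open[of _ _ _ "{0<..}"])
        (use r deriv_u w_pos in \<open>force simp: slope_def\<close>)+
  qed
qed

text \<open>The potential is a nondecreasing primitive of a nonnegative function; once bounded, it
  converges at infinity, and the fundamental theorem gives integrability. The contrapositive turns
  the hypothesis on \<open>Theta\<close> into unboundedness.\<close>

lemma integrable_slope_if_potential_bounded:
  assumes "\<And>r. r \<ge> 0 \<Longrightarrow> potential (\<lambda>_. 1) r \<le> C"
  shows "set_integrable lborel {0<..} (slope (\<lambda>_. 1))"
proof -
  define F where "F = potential (\<lambda>_. 1)"
  have dF: "(F has_real_derivative slope (\<lambda>_. 1) r) (at r within {0..})" if "r \<ge> 0" for r
    unfolding F_def using that by (intro potential_has_derivative) auto
  have F_mono: "F r \<le> F s" if "0 \<le> r" "r \<le> s" for r s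
  proof (rule DERIV_nonneg_imp_increasing_open[OF that(2)])
    show "\<exists>y. (F has_real_derivative y) (at x) \<and> y \<ge> 0" if x: "r < x" "x < s" for x
      using dF[of x] x \<open>0 \<le> r\<close> slope_nonneg[of "\<lambda>_. 1" x] by (auto simp: at_within_halfline)
    have "continuous_on {0..} F" using dF by (auto intro!: DERIV_continuous_on)
    then show "continuous_on {r..s} F" by (rule continuous_on_subset) (use that in auto)
  qed
  have "(F \<longlongrightarrow> F 0) (at 0 within {0..})"
    using DERIV_continuous[OF dF[of 0]] by (simp add: continuous_within)
  then have F_0: "(F \<longlongrightarrow> 0) (at_right 0)"
    by (rule tendsto_within_subset[where S="{0..}", THEN tendsto_eq_rhs]) (auto simp: F_def)
  have "\<exists>B. (F \<longlongrightarrow> B) at_top"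
  proof (intro exI order_tendstoI)
    have bdd: "bdd_above (F ` {0..})" using assms by (auto simp: bdd_above_def F_def)
    fix y assume "y < Sup (F ` {0..})"
    then obtain r where r: "r \<ge> 0" "y < F r" using less_cSup_iff[OF _ bdd] by auto
    show "\<forall>\<^sub>F s in at_top. y < F s"
      using eventually_ge_at_top[of r] by eventually_elim (use F_mono r in force)
  next
    have bdd: "bdd_above (F ` {0..})" using assms by (auto simp: bdd_above_def F_def)
    fix y assume y: "Sup (F ` {0..}) < y"
    show "\<forall>\<^sub>F s in at_top. F s < y"
      using eventually_ge_at_top[of 0]
      by eventually_elim (use cSup_upper[OF _ bdd] y in force)
  qed
  then obtain B where B: "(F \<longlongrightarrow> B) at_top" by blast
  have "set_integrable lborel (einterval 0 \<infinity>) (slope (\<lambda>_. 1))"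
  proof (rule interval_integral_FTC_nonneg(1)[where F=F])
    show "(F has_real_derivative slope (\<lambda>_. 1) x) (at x)" if "0 < ereal x" for x
      using dF[of x] that by (auto simp: at_within_halfline)
    show "isCont (slope (\<lambda>_. 1)) x" if "0 < ereal x" for x
      using DERIV_isCont[OF slope_has_derivative[of "\<lambda>_. 1" x]] that by auto
    show "AE x in lborel. 0 < ereal x \<longrightarrow> ereal x < \<infinity> \<longrightarrow> 0 \<le> slope (\<lambda>_. 1) x"
      by (intro AE_I2) (auto intro!: slope_nonneg)
    show "((F \<circ> real_of_ereal) \<longlongrightarrow> 0) (at_right 0)"
      using F_0 by (simp add: ereal_tendsto_simps zero_ereal_def)
    show "((F \<circ> real_of_ereal) \<longlongrightarrow> B) (at_left \<infinity>)"
      using B by (simp add: ereal_tendsto_simps)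
  qed auto
  moreover have "einterval 0 \<infinity> = {0<..}" by (auto simp: einterval_def)
  ultimately show ?thesis by simp
qed

end

text \<open>By \<open>le\<close>, \<open>G\<close> is the graph of an order isomorphism;
  antisymmetry gives uniqueness and \<open>ex2\<close> surjectivity. A monotone function whose image
  is open cannot jump, whence continuity.\<close>

lemma increasing_solution_curve:
  fixes G :: "real \<Rightarrow> real \<Rightarrow> bool"
  assumes ex1: "\<And>x. x > 0 \<Longrightarrow> \<exists>y>0. G x y" and ex2: "\<And>y. y > 0 \<Longrightarrow> \<exists>x>0. G x y"
    and le: "\<And>x1 y1 x2 y2. G x1 y1 \<Longrightarrow> G x2 y2 \<Longrightarrow> x1 \<le> x2 \<longleftrightarrow> y1 \<le> y2"
  obtains \<eta> where "\<And>x. x > 0 \<Longrightarrow> \<eta> x > 0" "\<And>x. x > 0 \<Longrightarrow> G x (\<eta> x)" "\<And>x y. x > 0 \<Longrightarrow> G x y \<Longrightarrow> y = \<eta> x"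
    "continuous_on {0<..} \<eta>" "strict_mono_on {0<..} \<eta>" "bij_betw \<eta> {0<..} {0<..}"
proof -
  obtain \<eta> where \<eta>: "\<And>x. x > 0 \<Longrightarrow> \<eta> x > 0" "\<And>x. x > 0 \<Longrightarrow> G x (\<eta> x)" using ex1 by metis
  have unique: "y = \<eta> x" if "x > 0" "G x y" for x y
    using le[OF that(2) \<eta>(2)[OF that(1)]] le[OF \<eta>(2)[OF that(1)] that(2)] by auto
  have less: "\<eta> x < \<eta> y" if "0 < x" "x < y" for x y
    using le[OF \<eta>(2)[of y] \<eta>(2)[of x]] that by auto
  then have mono: "strict_mono_on {0<..} \<eta>" by (auto simp: strict_mono_on_def)
  have "y \<in> \<eta> ` {0<..}" if "y > 0" for y
    using ex2[OF that] unique by (metis greaterThan_iff imageI)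
  then have image: "\<eta> ` {0<..} = {0<..}" using \<eta>(1) by auto
  have "continuous_on {0<..} \<eta>"
    using less by (intro continuous_onI_mono) (auto simp: image le_less)
  then show ?thesis
    using that[of \<eta>] \<eta> unique mono image strict_mono_on_imp_inj_on[OF mono]
    by (auto simp: bij_betw_def)
qed

section \<open>Consequences of convexity of the model function\<close>

lemma cartan_hadamard_modelD:
  assumes "cartan_hadamard_model \<psi>"
  shows "continuous_on {0..} \<psi>" "\<psi> 0 = 0" "r > 0 \<Longrightarrow> \<psi> r > 0"
    "r > 0 \<Longrightarrow> (\<psi> has_real_derivative deriv \<psi> r) (at r)" "continuous_on {0<..} (deriv \<psi>)"
    "convex_on {0..} \<psi>"
proof -
  have model: "model_function \<psi>" and convex: "convex_on {0..} \<psi>"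
    using assms by (auto simp: cartan_hadamard_model_def)
  then have Ck: "Ck_on 1 \<psi> {0<..}" by (simp add: model_function_def)
  show "continuous_on {0..} \<psi>"
    using model by (auto simp: model_function_def intro: C1_halfline_continuous)
  show "\<psi> 0 = 0" "r > 0 \<Longrightarrow> \<psi> r > 0"
    using model by (auto simp: model_function_def)
  show "(\<psi> has_real_derivative deriv \<psi> r) (at r)" if "r > 0"
    using Ck that by (auto simp: Ck_on_def DERIV_deriv_iff_real_differentiable)
  show "continuous_on {0<..} (deriv \<psi>)" using Ck by (simp add: Ck_on_def)
qed (use assms in \<open>simp add: cartan_hadamard_model_def\<close>)

text \<open>The graph of a convex function lies below its chord from the origin, so
  \<open>\<psi> r \<le> r / s * \<psi> s\<close>.\<close>

lemma cartan_hadamard_model_mono: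
  assumes \<psi>: "cartan_hadamard_model \<psi>" and r: "0 \<le> r" "r \<le> s"
  shows "\<psi> r \<le> \<psi> s"
proof (cases "s = 0")
  case False
  note D = cartan_hadamard_modelD[OF \<psi>]
  have s: "s > 0" using r False by simp
  have "\<psi> ((1 - r / s) *\<^sub>R 0 + (r / s) *\<^sub>R s) \<le> (1 - r / s) * \<psi> 0 + r / s * \<psi> s"
    using r s by (intro convex_onD[OF D(6)]) auto
  then have "\<psi> r \<le> r / s * \<psi> s" using D(2) s by simp
  also have "\<dots> \<le> 1 * \<psi> s" using r s D(3)[OF s] by (intro mult_right_mono) auto
  finally show ?thesis by simp
qed (use r in auto)

lemma radial_weight_cartan_hadamard:
  assumes n: "n \<ge> 2" and \<psi>: "cartan_hadamard_model \<psi>"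
  shows "radial_weight (\<lambda>r. \<psi> r ^ (n - 1)) (\<lambda>r. real (n - 1) * \<psi> r ^ (n - 2) * deriv \<psi> r)"
proof
  note D = cartan_hadamard_modelD[OF \<psi>]
  show "continuous_on {0..} (\<lambda>r. \<psi> r ^ (n - 1))" by (intro continuous_intros D)
  show "\<psi> 0 ^ (n - 1) = 0" using n D by simp
  show "\<psi> r ^ (n - 1) > 0" if "r > 0" for r using D(3)[OF that] by simp
  show "\<psi> r ^ (n - 1) \<le> \<psi> s ^ (n - 1)" if "0 \<le> r" "r \<le> s" for r s
    using that cartan_hadamard_model_mono[OF \<psi> that] D(2) D(3)[of r]
    by (intro power_mono) (cases "r = 0"; auto)+
  show "((\<lambda>r. \<psi> r ^ (n - 1)) has_real_derivative real (n - 1) * \<psi> r ^ (n - 2) * deriv \<psi> r) (at r)"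
    if "r > 0" for r
    using DERIV_power[OF D(4)[OF that], of "n - 1"] by (simp add: numeral_2_eq_2 mult_ac)
  show "continuous_on {0<..} (\<lambda>r. real (n - 1) * \<psi> r ^ (n - 2) * deriv \<psi> r)"
    by (intro continuous_intros D(5) continuous_on_subset[OF D(1)]) auto
qed

text \<open>The inequality behind the Pohozaev sign condition; it is an equality for \<open>\<psi>(r) = r\<close>.\<close>

lemma cartan_hadamard_model_power_le:
  assumes \<psi>: "cartan_hadamard_model \<psi>" and n: "n \<ge> 1" and r: "r > 0"
  shows "\<psi> r ^ n \<le> real n * deriv \<psi> r * integral {0..r} (\<lambda>s. \<psi> s ^ (n - 1))"
proof -
  note D = cartan_hadamard_modelD[OF \<psi>]
  \<comment> \<open>Adding the tangent inequalities at \<open>x\<close> and at \<open>r\<close>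
    shows that the derivative of a convex function is nondecreasing.\<close>
  have tangent: "deriv \<psi> x * (y - x) \<le> \<psi> y - \<psi> x" if "x > 0" "y > 0" for x y
    using that D(4)[OF that(1)]
    by (intro convex_on_imp_above_tangent[OF D(6)])
      (auto simp: interior_Ici[of "-1"] connected_Ici at_within_halfline)
  have deriv_mono: "deriv \<psi> x \<le> deriv \<psi> r" if "0 < x" "x < r" for x
  proof -
    have "deriv \<psi> x * (r - x) \<le> deriv \<psi> r * (r - x)"
      using tangent[of x r] tangent[of r x] that r by (simp add: algebra_simps)
    then show ?thesis using that by simp
  qed
  define J where "J x = integral {0..x} (\<lambda>s. \<psi> s ^ (n - 1))" for x
  have J: "(J has_real_derivative \<psi> x ^ (n - 1)) (at x within {0..})" if "x \<ge> 0" for x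
    unfolding J_def by (intro integral_has_real_derivative_halfline continuous_intros D that)
  \<comment> \<open>With \<open>deriv \<psi> r\<close> frozen at the endpoint, \<open>g' x\<close>
    is \<open>n * \<psi> x ^ (n - 1)\<close> times \<open>deriv \<psi> r - deriv \<psi> x\<close>,
    hence nonnegative.\<close>
  define g where "g x = real n * deriv \<psi> r * J x - \<psi> x ^ n" for x
  have "g 0 \<le> g r"
  proof (rule DERIV_nonneg_imp_increasing_open[of 0 r g])
    fix x assume x: "0 < x" "x < r"
    have "(J has_real_derivative \<psi> x ^ (n - 1)) (at x)"
      using J[of x] x by (auto simp: at_within_halfline)
    then have "(g has_real_derivative
        real n * deriv \<psi> r * \<psi> x ^ (n - 1) - real n * (deriv \<psi> x * \<psi> x ^ (n - Suc 0))) (at x)"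
      unfolding g_def[abs_def]
      by (intro DERIV_diff DERIV_cmult DERIV_power D(4) x)
    moreover have "real n * (deriv \<psi> x * \<psi> x ^ (n - Suc 0)) \<le> real n * deriv \<psi> r * \<psi> x ^ (n - 1)"
      using deriv_mono[OF x] D(3)[OF x(1)] by (simp add: mult_right_mono mult.assoc mult_left_mono)
    ultimately show "\<exists>y. (g has_real_derivative y) (at x) \<and> 0 \<le> y" by force
  next
    have "continuous_on {0..} J" using J by (auto intro!: DERIV_continuous_on)
    then have "continuous_on {0..} g" unfolding g_def by (intro continuous_intros D)
    then show "continuous_on {0..r} g" by (rule continuous_on_subset) auto
  qed (use r in auto)
  moreover have "g 0 = 0" using D(2) n by (simp add: g_def J_def)
  ultimately have "0 \<le> g r" by simp
  then show ?thesis by (simp add: g_def J_def)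
qed

theorem theorem1p1:
  fixes \<psi> :: "real \<Rightarrow> real" and n :: nat and p q :: real
  assumes "n \<ge> 3"
    and "cartan_hadamard_model \<psi>"
    and "\<not> set_integrable lborel {0<..} (Theta \<psi> n)"
    and "p > 0" and "q > 0"
    and "1 / (p + 1) + 1 / (q + 1) \<le> (real n - 2) / real n"
  shows "\<exists>\<eta> :: real \<Rightarrow> real.
     (\<forall>\<xi>>0. \<eta> \<xi> > 0 \<and>
        (\<exists>u v. globally_positive_solution \<psi> n p q \<xi> (\<eta> \<xi>) u v) \<and>
        (\<forall>\<eta>'>0. (\<exists>u v. globally_positive_solution \<psi> n p q \<xi> \<eta>' u v) \<longrightarrow> \<eta>' = \<eta> \<xi>) \<and>
        (\<forall>u v. globally_positive_solution \<psi> n p q \<xi> (\<eta> \<xi>) u v \<longrightarrow>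
           (u \<longlongrightarrow> 0) at_top \<and> (v \<longlongrightarrow> 0) at_top)) \<and>
     continuous_on {0<..} \<eta> \<and> strict_mono_on {0<..} \<eta> \<and> bij_betw \<eta> {0<..} {0<..}"
proof -
  note D = cartan_hadamard_modelD[OF assms(2)]
  define w where "w r = \<psi> r ^ (n - 1)" for r
  define w' where "w' r = real (n - 1) * \<psi> r ^ (n - 2) * deriv \<psi> r" for r
  interpret radial_weight w w'
    unfolding w_def[abs_def] w'_def[abs_def]
    by (rule radial_weight_cartan_hadamard) (use assms in auto)

  have flux_1: "flux (\<lambda>_. 1) r = integral {0..r} (\<lambda>s. \<psi> s ^ (n - 1))" for r
    by (simp add: flux_def w_def)
  \<comment> \<open>\<open>Theta\<close> is written with a Lebesgue integral and \<open>flux\<close>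
    with a gauge integral; they agree for the continuous weight.\<close>
  have "slope (\<lambda>_. 1) r = Theta \<psi> n r" for r
  proof -
    have "set_integrable lborel {0..r} w"
      by (intro borel_integrable_atLeastAtMost' continuous_on_subset[OF w_cont]) auto
    then have "(LINT s:{0..r}|lborel. \<psi> s ^ (n - 1)) = integral {0..r} (\<lambda>s. \<psi> s ^ (n - 1))"
      unfolding w_def[abs_def] by (rule set_borel_integral_eq_integral)
    then show ?thesis by (simp add: slope_def Theta_def flux_1 w_def)
  qed
  then have unbounded: "\<exists>r\<ge>0. potential (\<lambda>_. 1) r > C" for C
    using integrable_slope_if_potential_bounded[of C] assms(3) by (metis ext not_less)

  \<comment> \<open>The exponent condition bounds the constant by
    \<open>1 + (n - 2) / n = 2 * (n - 1) / n\<close>; one factor \<open>\<psi> r ^ n\<close> of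
    \<open>(w r)\<^sup>2\<close> is then estimated through convexity.\<close>
  have crit: "(1 + 1 / (p + 1) + 1 / (q + 1)) * (w r)\<^sup>2 \<le> 2 * flux (\<lambda>_. 1) r * w' r" if "r > 0" for r
  proof -
    have "(1 + 1 / (p + 1) + 1 / (q + 1)) * (w r)\<^sup>2 \<le> (1 + (real n - 2) / real n) * (w r)\<^sup>2"
      using assms(6) by (intro mult_right_mono) auto
    also have "\<dots> = 2 * real (n - 1) / real n * \<psi> r ^ (n - 2) * \<psi> r ^ n"
    proof -
      have "(n - 1) * 2 = (n - 2) + n" using assms(1) by simp
      then have "(w r)\<^sup>2 = \<psi> r ^ (n - 2) * \<psi> r ^ n"
        by (simp add: w_def flip: power_mult power_add)
      moreover have "1 + (real n - 2) / real n = 2 * real (n - 1) / real n"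
        using assms(1) by (simp add: field_simps of_nat_diff)
      ultimately show ?thesis by simp
    qed
    also have "\<dots> \<le> 2 * real (n - 1) / real n * \<psi> r ^ (n - 2) * (real n * deriv \<psi> r * flux (\<lambda>_. 1) r)"
      unfolding flux_1 using assms(1) D(3)[OF that]
      by (intro mult_left_mono cartan_hadamard_model_power_le assms that) auto
    also have "\<dots> = 2 * flux (\<lambda>_. 1) r * w' r"
      using assms(1) by (simp add: w'_def)
    finally show ?thesis .
  qed

  \<comment> \<open>On positive values the truncated power equals the nonlinearity of the Cauchy
    problem, so globally positive solutions of both systems coincide.\<close>
  have power_eq: "\<psi> r ^ (n - 1) * \<bar>x\<bar> powr (s - 1) * x = w r * pos_power s x" if "x > 0" for r x s :: real
    using that by (simp add: w_def pos_power_def powr_diff)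
  have iff: "globally_positive_solution \<psi> n p q \<xi> \<eta> u v \<longleftrightarrow>
      solution q p \<xi> \<eta> u v \<and> (\<forall>r\<ge>0. u r > 0 \<and> v r > 0)" for \<xi> \<eta> u v
  proof (cases "\<forall>r\<ge>0. u r > 0 \<and> v r > 0")
    case True
    have pos: "u r > 0" "v r > 0" if "r > 0" for r using True that by auto
    have eq: "((\<lambda>s. \<psi> s ^ (n - 1) * deriv f s) has_real_derivative
          - (\<psi> r ^ (n - 1) * \<bar>x\<bar> powr (s - 1) * x)) (at r) \<longleftrightarrow>
        ((\<lambda>s. w s * deriv f s) has_real_derivative - (w r * pos_power s x)) (at r)"
      if "x > 0" for f r s x
      by (simp only: power_eq[OF that] w_def)
    have "solves_CP \<psi> n p q \<xi> \<eta> u v \<longleftrightarrow> solution q p \<xi> \<eta> u v"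
    proof
      assume CP: "solves_CP \<psi> n p q \<xi> \<eta> u v"
      have C1: "C1_halfline u" "C1_halfline v" and init: "u 0 = \<xi>" "v 0 = \<eta>"
        using CP by (auto simp: solves_CP_def)
      have cont: "continuous_on {0..} u" "continuous_on {0..} v"
        using C1 by (auto intro: C1_halfline_continuous)
      have eqs: "((\<lambda>s. w s * deriv u s) has_real_derivative - (w r * pos_power q (v r))) (at r)"
        "((\<lambda>s. w s * deriv v s) has_real_derivative - (w r * pos_power p (u r))) (at r)" if "r > 0" for r
        using CP that eq[OF pos(1)[OF that]] eq[OF pos(2)[OF that]] unfolding solves_CP_def by blast+
      have "u r = u 0 - potential (\<lambda>s. pos_power q (v s)) r" if "r \<ge> 0" for r
        by (intro integrate_radial_equation continuous_intros C1 cont assms eqs that)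
      moreover have "v r = v 0 - potential (\<lambda>s. pos_power p (u s)) r" if "r \<ge> 0" for r
        by (intro integrate_radial_equation continuous_intros C1 cont assms eqs that)
      ultimately show "solution q p \<xi> \<eta> u v"
        using cont init by (auto simp: solution_def)
    next
      assume s: "solution q p \<xi> \<eta> u v"
      note SD = solutionD[OF s]
      have c: "continuous_on {0..} (\<lambda>s. pos_power q (v s))" "continuous_on {0..} (\<lambda>s. pos_power p (u s))"
        by (intro continuous_intros SD assms)+
      show "solves_CP \<psi> n p q \<xi> \<eta> u v"
        using radial_equation_of_potential[OF c(1) SD(5)] radial_equation_of_potential[OF c(2) SD(6)]
          SD(3,4) eq[OF pos(1)] eq[OF pos(2)]
        unfolding solves_CP_def by blast
    qed
    then show ?thesis using True by (simp add: globally_positive_solution_def)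
  qed (auto simp: globally_positive_solution_def)

  define G where "G \<xi> \<eta> \<longleftrightarrow> (\<exists>u v. globally_positive_solution \<psi> n p q \<xi> \<eta> u v)" for \<xi> \<eta>
  have G_iff: "G \<xi> \<eta> \<longleftrightarrow> (\<exists>u v. solution q p \<xi> \<eta> u v \<and> (\<forall>r\<ge>0. u r > 0 \<and> v r > 0))" for \<xi> \<eta>
    by (simp add: G_def iff)
  have ex1: "\<exists>\<eta>>0. G \<xi> \<eta>" if "\<xi> > 0" for \<xi>
    using global_solution_exists[OF assms(5,4) that crit] by (simp add: G_iff)
  have crit': "(1 + 1 / (q + 1) + 1 / (p + 1)) * (w r)\<^sup>2 \<le> 2 * flux (\<lambda>_. 1) r * w' r" if "r > 0" for r
    using crit[OF that] by (simp add: add_ac)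
  \<comment> \<open>Shooting in \<open>\<xi>\<close> for given \<open>\<eta>\<close>: the critical
    condition is symmetric in \<open>p\<close> and \<open>q\<close>, so the swapped system
    qualifies.\<close>
  have ex2: "\<exists>\<xi>>0. G \<xi> \<eta>" if "\<eta> > 0" for \<eta>
    using global_solution_exists[OF assms(4,5) that crit'] unfolding G_iff solution_swap[of q] by blast
  \<comment> \<open>One implication is monotonicity of the data; the other is the same fact for the
    swapped system.\<close>
  have le: "\<xi>1 \<le> \<xi>2 \<longleftrightarrow> \<eta>1 \<le> \<eta>2" if "G \<xi>1 \<eta>1" "G \<xi>2 \<eta>2" for \<xi>1 \<eta>1 \<xi>2 \<eta>2
  proof -
    obtain u1 v1 where s1: "solution q p \<xi>1 \<eta>1 u1 v1" "\<And>r. r \<ge> 0 \<Longrightarrow> u1 r > 0 \<and> v1 r > 0"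
      using \<open>G \<xi>1 \<eta>1\<close> unfolding G_iff by blast
    obtain u2 v2 where s2: "solution q p \<xi>2 \<eta>2 u2 v2" "\<And>r. r \<ge> 0 \<Longrightarrow> u2 r > 0 \<and> v2 r > 0"
      using \<open>G \<xi>2 \<eta>2\<close> unfolding G_iff by blast
    show ?thesis
      using global_solution_data_mono[OF s2(1) s1(1) assms(5,4) s2(2) s1(2) unbounded]
        global_solution_data_mono[OF s2(1)[unfolded solution_swap[of q]]
          s1(1)[unfolded solution_swap[of q]] assms(4,5) _ _ unbounded] s1(2) s2(2) by blast
  qed
  obtain \<eta> where \<eta>: "\<And>x. x > 0 \<Longrightarrow> \<eta> x > 0" "\<And>x. x > 0 \<Longrightarrow> G x (\<eta> x)"
    "\<And>x y. x > 0 \<Longrightarrow> G x y \<Longrightarrow> y = \<eta> x"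
    "continuous_on {0<..} \<eta>" "strict_mono_on {0<..} \<eta>" "bij_betw \<eta> {0<..} {0<..}"
    using increasing_solution_curve[of G, OF ex1 ex2 le] by blast
  have "(u \<longlongrightarrow> 0) at_top \<and> (v \<longlongrightarrow> 0) at_top"
    if "globally_positive_solution \<psi> n p q \<xi> \<eta> u v" for \<xi> \<eta> u v
  proof -
    have s: "solution q p \<xi> \<eta> u v" and pos: "\<And>r. r \<ge> 0 \<Longrightarrow> u r > 0 \<and> v r > 0"
      using that by (auto simp: iff)
    show ?thesis
      using global_solution_tendsto_0[OF s assms(5,4) pos unbounded]
        global_solution_tendsto_0[OF s[unfolded solution_swap[of q]] assms(4,5) _ unbounded] pos
      by blast
  qed
  then show ?thesis using \<eta> by (intro exI[of _ \<eta>]) (auto simp: G_def)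
qed

end
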